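(* For every integer $d\geq 2$, for the Constrained-degree percolation model on the hypercubic lattice $\mathbb{L}^d$ with degree restriction $k_v=2$ for all $v\in\mathbb{Z}^d$, it holds that $$\theta^{\mathbb{L}^d,(2)}(t)=0\quad\text{for all } t\in[0,1].$$
   Context: $\mathbb{L}^d$ denotes the hypercubic lattice: the graph with vertex set $\mathbb{Z}^d$ and edges between nearest neighbours (points at $\ell_1$-distance 1). Constrained-degree percolation model. Let $G=(\mathbb{V},\mathbb{E})$ be an infinite connected graph of bounded degree with a distinguished vertex $0$ (the origin), and let $\kappa=(k_v)_{v\in\mathbb{V}}$ be integers (the degree restrictions). Let $U=(U_e)_{e\in\mathbb{E}}$ be i.i.d. random variables uniform on $[0,1]$, i.e. the coordinates on $[0,1]^{\mathbb{E}}$ with the cylinder $\sigma$-algebra and the product $P$ of Lebesgue measures. At time $0$ all edges are closed. Each edge $e=\langle u_1,u_2\rangle$ tries to open at time $U_e$; it succeeds, and then remains open forever, if and only if just before that time each endpoint $u_i$ ($i=1,2$) has strictly fewer than $k_{u_i}$ open incident edges; otherwise it stays closed forever. Formally, the configuration $\omega_t=\omega_t^{G,\kappa}(U)\in\{0,1\}^{\mathbb{E}}$ at time $t\in[0,1]$ is the ($P$-a.s. well-defined) one such that for $e=\langle u_1,u_2\rangle$, $$\omega_{t,e}=\mathbf 1\{U_e<t\}\prod_{i=1}^{2}\mathbf 1\bigl\{\#\{v\in\mathbb{V}\setminus\{u_{3-i}\}: \langle u_i,v\rangle\in\mathbb{E},\ \omega_{U_e,\langle u_i,v\rangle}=1\}<k_{u_i}\bigr\}.$$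 The event $\{0\leftrightarrow\infty\text{ at }t\}$ is that infinitely many vertices are connected to the origin by paths of edges open in $\omega_t$ (i.e. with $\omega_{t,e}=1$). Set $\theta^{G,\kappa}(t)=P\{0\leftrightarrow\infty\text{ at }t\}$. For an integer $k$, $(k)$ denotes the constant restriction $k_v=k$ for all $v$. *)

theory Defs
  imports "HOL-Probability.Probability"
begin

text \<open>
  A simple graph is given by its edge set \<open>E\<close>, a set of two-element sets of vertices; the vertex
  set is the whole type \<open>'v\<close>. Graphs are meant to be locally finite, so that \<open>card\<close> is a genuine count.
\<close>

definition cdp_space :: "'v set set \<Rightarrow> ('v set \<Rightarrow> real) measure" where
  "cdp_space E = Pi\<^sub>M E (\<lambda>_. restrict_space lborel {0..1})"

text \<open>
  \<open>\<omega> t e\<close> says that \<open>e\<close> is open at time \<open>t\<close>. Outside \<open>t \<in> [0,1]\<close>, \<open>e \<in> E\<close> it is set to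
  \<open>False\<close>, so that uniqueness can be expressed for the total function \<open>\<omega>\<close>. Each edge has two
  presentations \<open>{u, w}\<close>, one for each choice of \<open>u\<close> among its endpoints.
\<close>

definition is_cdp_config ::
  "'v set set \<Rightarrow> ('v \<Rightarrow> int) \<Rightarrow> ('v set \<Rightarrow> real) \<Rightarrow> (real \<Rightarrow> 'v set \<Rightarrow> bool) \<Rightarrow> bool" where
  "is_cdp_config E k U \<omega> \<longleftrightarrow>
    (\<forall>t e. \<omega> t e \<longleftrightarrow>
      t \<in> {0..1} \<and> e \<in> E \<and> U e < t \<and>
      (\<forall>u w. e = {u, w} \<longrightarrow>
        int (card {v. v \<noteq> w \<and> {u, v} \<in> E \<and> \<omega> (U e) {u, v}}) < k u))"

definition cdp_config ::
  "'v set set \<Rightarrow> ('v \<Rightarrow> int) \<Rightarrow> ('v set \<Rightarrow> real) \<Rightarrow> real \<Rightarrow> 'v set \<Rightarrow> bool" where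
  "cdp_config E k U = (THE \<omega>. is_cdp_config E k U \<omega>)"

definition open_connected :: "'v set set \<Rightarrow> ('v set \<Rightarrow> bool) \<Rightarrow> 'v \<Rightarrow> 'v \<Rightarrow> bool" where
  "open_connected E \<eta> = (\<lambda>x y. {x, y} \<in> E \<and> \<eta> {x, y})\<^sup>*\<^sup>*"

definition percolation_event ::
  "'v set set \<Rightarrow> ('v \<Rightarrow> int) \<Rightarrow> 'v \<Rightarrow> real \<Rightarrow> ('v set \<Rightarrow> real) set" where
  "percolation_event E k a t =
    {U \<in> space (cdp_space E). infinite {x. open_connected E (cdp_config E k U t) a x}}"

text \<open>
  The completion is taken because \<open>cdp_config\<close> is only almost surely determined by its equation;
  see \<open>hypercubic_AE_unique_cdp_config\<close> and
  \<open>hypercubic_percolation_event_measurable\<close>.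
\<close>

definition cdp_theta :: "'v set set \<Rightarrow> ('v \<Rightarrow> int) \<Rightarrow> 'v \<Rightarrow> real \<Rightarrow> real" where
  "cdp_theta E k a t = measure (completion (cdp_space E)) (percolation_event E k a t)"

definition hypercubic_edges :: "(int ^ 'd::finite) set set" where
  "hypercubic_edges = {{x, y} | x y. (\<Sum>i\<in>UNIV. \<bar>x $ i - y $ i\<bar>) = 1}"

text \<open>
  On a graph of bounded degree the configuration is almost surely well defined, and
  percolation events belong to the completed \<open>\<sigma>\<close>-algebra: the equation is solved by well-founded
  recursion along adjacent edges with earlier times, and infinite chains of such edges have
  probability zero.
\<close>

locale bounded_degree_graph =
  fixes E :: "'v::countable set set" and D :: nat
  assumes simple: "e \<in> E \<Longrightarrow> \<exists>u w. u \<noteq> w \<and> e = {u, w}"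
    and finite_nbrs: "finite {v. {u, v} \<in> E}"
    and degree_le: "card {v. {u, v} \<in> E} \<le> D"
begin

definition adj_edges :: "'v set \<Rightarrow> 'v set set" where
  "adj_edges e = {f \<in> E. f \<inter> e \<noteq> {}}"

definition earlier :: "('v set \<Rightarrow> real) \<Rightarrow> ('v set \<times> 'v set) set" where
  "earlier U = {(f, e). e \<in> E \<and> f \<in> adj_edges e \<and> U f < U e}"

lemma adj_edges_bound:
  assumes "e \<in> E"
  shows "finite (adj_edges e)" and "card (adj_edges e) \<le> 2 * D"
proof -
  obtain u w where e: "e = {u, w}" using simple[OF assms] by blast
  let ?S = "(\<lambda>v. {u, v}) ` {v. {u, v} \<in> E} \<union> (\<lambda>v. {w, v}) ` {v. {w, v} \<in> E}"
  have sub: "adj_edges e \<subseteq> ?S"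
  proof
    fix f assume f: "f \<in> adj_edges e"
    then obtain x where x: "x \<in> f" "x = u \<or> x = w" "f \<in> E"
      unfolding adj_edges_def e by blast
    obtain y where "f = {x, y}" using simple[OF x(3)] x(1) by (elim exE conjE) (metis insertE insert_commute singletonD)
    then show "f \<in> ?S" using x by blast
  qed
  have fin: "finite ?S" using finite_nbrs by simp
  show "finite (adj_edges e)" by (rule finite_subset[OF sub fin])
  have "card (adj_edges e) \<le> card ?S" by (rule card_mono[OF fin sub])
  also have "\<dots> \<le> card ((\<lambda>v. {u, v}) ` {v. {u, v} \<in> E}) + card ((\<lambda>v. {w, v}) ` {v. {w, v} \<in> E})"
    by (rule card_Un_le)
  also have "\<dots> \<le> D + D"
    by (intro add_mono order_trans[OF card_image_le[OF finite_nbrs] degree_le])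
  finally show "card (adj_edges e) \<le> 2 * D" by simp
qed

text \<open>The equation for the edges that open at all, with the truncation at time \<open>t\<close> left out.\<close>

definition step :: "('v \<Rightarrow> int) \<Rightarrow> ('v set \<Rightarrow> real) \<Rightarrow> ('v set \<Rightarrow> bool) \<Rightarrow> 'v set \<Rightarrow> bool" where
  "step k U A e \<longleftrightarrow> (\<forall>u w. e = {u, w} \<longrightarrow>
     int (card {v. v \<noteq> w \<and> {u, v} \<in> E \<and> U {u, v} < U e \<and> A {u, v}}) < k u)"

lemma step_cong:
  assumes "e \<in> E" "\<And>f. (f, e) \<in> earlier U \<Longrightarrow> A f = B f"
  shows "step k U A e = step k U B e"
proof -
  have eq: "{v. v \<noteq> w \<and> {u, v} \<in> E \<and> U {u, v} < U e \<and> A {u, v}} =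
        {v. v \<noteq> w \<and> {u, v} \<in> E \<and> U {u, v} < U e \<and> B {u, v}}" if "e = {u, w}" for u w
    using assms that by (auto simp: earlier_def adj_edges_def)
  have "(e = {u, w} \<longrightarrow>
        int (card {v. v \<noteq> w \<and> {u, v} \<in> E \<and> U {u, v} < U e \<and> A {u, v}}) < k u) \<longleftrightarrow>
      (e = {u, w} \<longrightarrow>
        int (card {v. v \<noteq> w \<and> {u, v} \<in> E \<and> U {u, v} < U e \<and> B {u, v}}) < k u)" for u w
    by (rule imp_cong[OF refl], drule eq) (simp only:)
  then show ?thesis unfolding step_def by (simp only:)
qed

lemma config_step:
  assumes U: "\<forall>e\<in>E. U e \<in> {0..1}"
  shows "is_cdp_config E k U \<omega> \<longleftrightarrow>
    (\<exists>A. (\<forall>t e. \<omega> t e \<longleftrightarrow> t \<in> {0..1} \<and> e \<in> E \<and> U e < t \<and> A e) \<and>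
         (\<forall>e. A e \<longleftrightarrow> e \<in> E \<and> step k U A e))" (is "_ \<longleftrightarrow> (\<exists>A. ?P A)")
proof
  assume w: "is_cdp_config E k U \<omega>"
  let ?A = "\<lambda>e. e \<in> E \<and> (\<forall>u w. e = {u, w} \<longrightarrow>
        int (card {v. v \<noteq> w \<and> {u, v} \<in> E \<and> \<omega> (U e) {u, v}}) < k u)"
  have 1: "\<omega> t e \<longleftrightarrow> t \<in> {0..1} \<and> e \<in> E \<and> U e < t \<and> ?A e" for t e
    using w unfolding is_cdp_config_def by blast
  define A where "A = ?A"
  have 1: "\<omega> t e \<longleftrightarrow> t \<in> {0..1} \<and> e \<in> E \<and> U e < t \<and> A e" for t e
    unfolding A_def by (rule 1)
  have 2: "\<omega> (U e) {u, v} \<longleftrightarrow> {u, v} \<in> E \<and> U {u, v} < U e \<and> A {u, v}" if "e \<in> E" for e u v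
    using 1[of "U e" "{u, v}"] U that by blast
  have "A e \<longleftrightarrow> step k U A e" if "e \<in> E" for e
  proof -
    have "{v. v \<noteq> w \<and> {u, v} \<in> E \<and> \<omega> (U e) {u, v}} =
        {v. v \<noteq> w \<and> {u, v} \<in> E \<and> U {u, v} < U e \<and> A {u, v}}" for u w
      using 2[OF that] by blast
    then show ?thesis
      using that unfolding step_def A_def[THEN fun_cong, of e] by (simp only: simp_thms)
  qed
  moreover have "A e \<Longrightarrow> e \<in> E" for e unfolding A_def by blast
  ultimately have "?P A" using 1 by blast
  then show "\<exists>A. ?P A" by (rule exI[of _ A])
next
  assume "\<exists>A. ?P A"
  then obtain A where 1: "\<And>t e. \<omega> t e \<longleftrightarrow> t \<in> {0..1} \<and> e \<in> E \<and> U e < t \<and> A e"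
    and 2: "\<And>e. A e \<longleftrightarrow> e \<in> E \<and> step k U A e" by blast
  have 3: "\<omega> (U e) {u, v} \<longleftrightarrow> {u, v} \<in> E \<and> U {u, v} < U e \<and> A {u, v}" if "e \<in> E" for e u v
    using 1[of "U e" "{u, v}"] U that by blast
  have 4: "A e \<longleftrightarrow> (\<forall>u w. e = {u, w} \<longrightarrow>
        int (card {v. v \<noteq> w \<and> {u, v} \<in> E \<and> \<omega> (U e) {u, v}}) < k u)" if "e \<in> E" for e
  proof -
    have "{v. v \<noteq> w \<and> {u, v} \<in> E \<and> \<omega> (U e) {u, v}} =
        {v. v \<noteq> w \<and> {u, v} \<in> E \<and> U {u, v} < U e \<and> A {u, v}}" for u w
      using 3[OF that] by blast
    then show ?thesis
      using that unfolding 2[of e] step_def by (simp only: simp_thms)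
  qed
  show "is_cdp_config E k U \<omega>"
    unfolding is_cdp_config_def
  proof (intro allI)
    fix t e
    show "\<omega> t e \<longleftrightarrow> t \<in> {0..1} \<and> e \<in> E \<and> U e < t \<and>
      (\<forall>u w. e = {u, w} \<longrightarrow>
        int (card {v. v \<noteq> w \<and> {u, v} \<in> E \<and> \<omega> (U e) {u, v}}) < k u)"
    proof (cases "e \<in> E")
      case True
      show ?thesis unfolding 1[of t e] 4[OF True] ..
    next
      case False
      then show ?thesis using 1[of t e] by (simp only: simp_thms)
    qed
  qed
qed

fun approx :: "('v \<Rightarrow> int) \<Rightarrow> nat \<Rightarrow> ('v set \<Rightarrow> real) \<Rightarrow> 'v set \<Rightarrow> bool" where
  "approx k 0 U e = (e \<in> E)"
| "approx k (Suc n) U e = (e \<in> E \<and> step k U (approx k n U) e)"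

lemma config_if_wf:
  assumes U: "\<forall>e\<in>E. U e \<in> {0..1}" and wf: "wf (earlier U)"
  shows "\<exists>!\<omega>. is_cdp_config E k U \<omega>"
    and "cdp_config E k U t e \<longleftrightarrow>
      t \<in> {0..1} \<and> e \<in> E \<and> U e < t \<and> (\<exists>n. \<forall>m\<ge>n. approx k m U e)"
proof -
  define A where "A = wfrec (earlier U) (\<lambda>A e. e \<in> E \<and> step k U A e)"
  have A: "A e \<longleftrightarrow> e \<in> E \<and> step k U A e" for e
  proof -
    have "A e \<longleftrightarrow> e \<in> E \<and> step k U (cut A (earlier U) e) e"
      using def_wfrec[OF eq_reflection[OF A_def] wf] .
    also have "\<dots> \<longleftrightarrow> e \<in> E \<and> step k U A e"
      using step_cong[of e U "cut A (earlier U) e" A] by (auto simp: cut_apply)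
    finally show ?thesis .
  qed
  have uniq: "B = A" if B: "\<And>e. B e \<longleftrightarrow> e \<in> E \<and> step k U B e" for B
  proof
    fix e show "B e = A e"
      using wf
    proof (induction e rule: wf_induct_rule)
      case (less e)
      then show ?case using A[of e] B[of e] step_cong[of e U B A k] by blast
    qed
  qed
  have ev: "\<exists>n. \<forall>m\<ge>n. approx k m U e = A e" for e
    using wf
  proof (induction e rule: wf_induct_rule)
    case (less e)
    show ?case
    proof (cases "e \<in> E")
      case False
      then have "approx k m U e = A e" for m using A[of e] by (cases m) simp_all
      then show ?thesis by blast
    next
      case True
      have "\<forall>f. \<exists>n. (f, e) \<in> earlier U \<longrightarrow> (\<forall>m\<ge>n. approx k m U f = A f)" using less by blast
      then obtain N where N: "\<And>f m. (f, e) \<in> earlier U \<Longrightarrow> m \<ge> N f \<Longrightarrow> approx k m U f = A f"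
        by metis
      define n where "n = Max (insert 0 (N ` adj_edges e))"
      have n: "N f \<le> n" if "(f, e) \<in> earlier U" for f
        unfolding n_def using that adj_edges_bound(1)[OF True] by (auto simp: earlier_def)
      have "approx k m U e = A e" if "m \<ge> Suc n" for m
      proof -
        define l where "l = m - 1"
        have l: "m = Suc l" "n \<le> l" using that by (simp_all add: l_def)
        have "step k U (approx k l U) e = step k U A e"
          using N[OF _ order_trans[OF n l(2)]] by (intro step_cong[OF True]) blast
        then show ?thesis using A[of e] l by simp
      qed
      then show ?thesis by blast
    qed
  qed
  define \<omega> where "\<omega> = (\<lambda>t e. t \<in> {0..1} \<and> e \<in> E \<and> U e < t \<and> A e)"
  have c: "is_cdp_config E k U \<omega>"
    unfolding config_step[OF U] \<omega>_def using A by blast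
  have u: "\<omega>' = \<omega>" if w': "is_cdp_config E k U \<omega>'" for \<omega>'
  proof -
    obtain B where 1: "\<And>t e. \<omega>' t e \<longleftrightarrow> t \<in> {0..1} \<and> e \<in> E \<and> U e < t \<and> B e"
      and 2: "\<And>e. B e \<longleftrightarrow> e \<in> E \<and> step k U B e"
      using w'[unfolded config_step[OF U]] by blast
    have "B = A" by (rule uniq) (rule 2)
    then show ?thesis by (intro ext) (simp add: 1 \<omega>_def)
  qed
  show "\<exists>!\<omega>. is_cdp_config E k U \<omega>" using c u by blast
  have "cdp_config E k U = \<omega>"
    unfolding cdp_config_def using c u by blast
  moreover have "A e \<longleftrightarrow> (\<exists>n. \<forall>m\<ge>n. approx k m U e)"
    using ev[of e] by (metis nat_le_linear)
  ultimately show "cdp_config E k U t e \<longleftrightarrow>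
      t \<in> {0..1} \<and> e \<in> E \<and> U e < t \<and> (\<exists>n. \<forall>m\<ge>n. approx k m U e)"
    by (simp add: \<omega>_def)
qed

fun edge_paths :: "'v set \<Rightarrow> nat \<Rightarrow> 'v set list set" where
  "edge_paths e 0 = {[e]}"
| "edge_paths e (Suc n) = (\<Union>f\<in>adj_edges e. (#) e ` edge_paths f n)"

lemma edge_paths_bound:
  assumes "e \<in> E"
  shows "finite (edge_paths e n)" and "card (edge_paths e n) \<le> (2 * D) ^ n"
    and "p \<in> edge_paths e n \<Longrightarrow> length p = Suc n \<and> set p \<subseteq> E"
proof -
  have "finite (edge_paths e n) \<and> card (edge_paths e n) \<le> (2 * D) ^ n \<and>
    (\<forall>p\<in>edge_paths e n. length p = Suc n \<and> set p \<subseteq> E)"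
    using assms
  proof (induction n arbitrary: e)
    case 0
    then show ?case by simp
  next
    case (Suc n)
    note ad = adj_edges_bound[OF Suc.prems]
    have IH: "finite (edge_paths f n)" "card (edge_paths f n) \<le> (2 * D) ^ n"
      "\<forall>p\<in>edge_paths f n. length p = Suc n \<and> set p \<subseteq> E" if "f \<in> adj_edges e" for f
      using Suc.IH[of f] that by (auto simp: adj_edges_def)
    have "card (edge_paths e (Suc n)) \<le> (\<Sum>f\<in>adj_edges e. card ((#) e ` edge_paths f n))"
      by (simp add: card_UN_le ad(1))
    also have "\<dots> \<le> (\<Sum>f\<in>adj_edges e. (2 * D) ^ n)"
      by (intro sum_mono) (meson IH card_image_le le_trans)
    also have "\<dots> \<le> (2 * D) ^ Suc n" using ad(2) by simp
    finally show ?case using IH ad(1) Suc.prems by auto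
  qed
  then show "finite (edge_paths e n)" and "card (edge_paths e n) \<le> (2 * D) ^ n"
    and "p \<in> edge_paths e n \<Longrightarrow> length p = Suc n \<and> set p \<subseteq> E" by blast+
qed

lemma chain_path:
  assumes "\<And>i. s (Suc i) \<in> adj_edges (s i)"
  shows "map s [i..<Suc (i + n)] \<in> edge_paths (s i) n"
proof (induction n arbitrary: i)
  case (Suc n)
  have "map s [i..<Suc (i + Suc n)] = s i # map s [Suc i..<Suc (Suc i + n)]"
    by (simp add: upt_conv_Cons del: upt_Suc)
  then show ?case using Suc[of "Suc i"] assms[of i] by fastforce
qed simp

abbreviation unit_interval :: "real measure" where
  "unit_interval \<equiv> restrict_space lborel {0..1}"

lemma prob_unit_interval: "prob_space unit_interval"
  by (rule prob_spaceI) (simp add: emeasure_restrict_space space_restrict_space)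

lemma slice_null:
  assumes e: "e \<in> E" and A: "A \<in> sets unit_interval"
    and q: "emeasure unit_interval A \<le> ennreal q" "0 \<le> q" "4 * real D * q \<le> 1"  "q \<le> 1"
  shows "{U \<in> space (cdp_space E). \<forall>n. \<exists>p\<in>edge_paths e n. distinct p \<and> (\<forall>f\<in>set p. U f \<in> A)}
    \<in> null_sets (cdp_space E)" (is "?N \<in> _")
proof -
  define M where "M = cdp_space E"
  define C where "C p = prod_emb E (\<lambda>_. unit_interval) (set p) (Pi\<^sub>E (set p) (\<lambda>_. A))" for p
  define G where "G n = (\<Union>p\<in>{p\<in>edge_paths e n. distinct p}. C p)" for n
  have C: "C p = {U \<in> space M. \<forall>f\<in>set p. U f \<in> A}" if "p \<in> edge_paths e n" for p n
    using edge_paths_bound(3)[OF e that]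
    by (auto simp: C_def prod_emb_def M_def cdp_space_def space_PiM PiE_iff extensional_def)
  have Cm: "C p \<in> sets M" if "p \<in> edge_paths e n" for p n
    unfolding C_def M_def cdp_space_def using edge_paths_bound(3)[OF e that] A
    by (intro sets_PiM_I) auto
  have Gm: "G n \<in> sets M" for n
    unfolding G_def using Cm edge_paths_bound(1)[OF e] by (intro sets.finite_UN) auto
  have Cq: "emeasure M (C p) \<le> ennreal (q ^ n)" if "p \<in> edge_paths e n" "distinct p" for p n
  proof -
    have p: "set p \<subseteq> E" "card (set p) = Suc n"
      using edge_paths_bound(3)[OF e that(1)] distinct_card[OF that(2)] by auto
    have "emeasure M (C p) = (\<Prod>f\<in>set p. emeasure unit_interval A)"
      unfolding M_def C_def cdp_space_def
      using p A prob_unit_interval by (intro emeasure_PiM_emb) auto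
    also have "\<dots> \<le> (\<Prod>f\<in>set p. ennreal q)"
      using q by (simp add: power_mono)
    also have "\<dots> = ennreal (q ^ Suc n)" using p q by (simp only: prod_constant ennreal_power)
    also have "\<dots> \<le> ennreal (q ^ n)"
      using q by (intro ennreal_leI power_decreasing) auto
    finally show ?thesis .
  qed
  have Gq: "emeasure M (G n) \<le> ennreal ((1 / 2) ^ n)" for n
  proof -
    have "emeasure M (G n) \<le> (\<Sum>p\<in>{p\<in>edge_paths e n. distinct p}. emeasure M (C p))"
      unfolding G_def using Cm edge_paths_bound(1)[OF e]
      by (intro emeasure_subadditive_finite) auto
    also have "\<dots> \<le> (\<Sum>p\<in>{p\<in>edge_paths e n. distinct p}. ennreal (q ^ n))"
      using Cq by (intro sum_mono) auto
    also have "\<dots> = ennreal (card {p\<in>edge_paths e n. distinct p} * q ^ n)"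
      using q by (simp add: ennreal_mult ennreal_of_nat_eq_real_of_nat)
    also have "\<dots> \<le> ennreal ((1 / 2) ^ n)"
    proof (rule ennreal_leI)
      have "card {p\<in>edge_paths e n. distinct p} \<le> card (edge_paths e n)"
        using edge_paths_bound(1)[OF e] by (intro card_mono) auto
      also have "\<dots> \<le> (2 * D) ^ n" by (rule edge_paths_bound(2)[OF e])
      finally have "real (card {p\<in>edge_paths e n. distinct p}) \<le> real ((2 * D) ^ n)"
        by (rule of_nat_mono)
      then have "real (card {p\<in>edge_paths e n. distinct p}) \<le> (2 * real D) ^ n"
        by simp
      then have "card {p\<in>edge_paths e n. distinct p} * q ^ n \<le> (2 * real D) ^ n * q ^ n"
        using q by (intro mult_right_mono) auto
      also have "\<dots> = (2 * real D * q) ^ n" by (simp add: power_mult_distrib)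
      also have "\<dots> \<le> (1 / 2) ^ n" using q by (intro power_mono) auto
      finally show "card {p\<in>edge_paths e n. distinct p} * q ^ n \<le> (1 / 2) ^ n" .
    qed
    finally show ?thesis .
  qed
  have N: "?N = (\<Inter>n. G n)"
  proof -
    have "U \<in> G n \<longleftrightarrow> U \<in> space M \<and> (\<exists>p\<in>edge_paths e n. distinct p \<and> (\<forall>f\<in>set p. U f \<in> A))"
      for U n unfolding G_def using C by blast
    then show ?thesis unfolding M_def by blast
  qed
  have Nm: "(\<Inter>n. G n) \<in> sets M" using Gm by blast
  have "emeasure M (\<Inter>n. G n) \<le> ennreal ((1 / 2) ^ n)" for n
    by (rule order_trans[OF emeasure_mono Gq]) (use Gm in auto)
  moreover have "(\<lambda>n. ennreal ((1 / 2) ^ n)) \<longlonglongrightarrow> ennreal 0"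
    by (intro tendsto_ennrealI LIMSEQ_power_zero) auto
  ultimately have "emeasure M (\<Inter>n. G n) \<le> ennreal 0"
    by (meson LIMSEQ_le_const)
  then show ?thesis unfolding N using Nm by (auto simp: M_def null_sets_def)
qed

lemma countable_E: "countable E"
proof (rule countable_subset)
  show "E \<subseteq> (\<lambda>(u, w). {u, w}) ` UNIV" using simple by fastforce
qed simp

lemma AE_wf_earlier: "AE U in cdp_space E. wf (earlier U)"
proof -
  define m where "m = 4 * D + 1"
  define A where "A j = {0..1} \<inter> {real j / real m..(real j + 1) / real m}" for j
  have m: "m > 0" by (simp add: m_def)
  define N where "N e j = {U \<in> space (cdp_space E). \<forall>n. \<exists>p\<in>edge_paths e n. distinct p \<and>
    (\<forall>f\<in>set p. U f \<in> A j)}" for e j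
  have "N e j \<in> null_sets (cdp_space E)" if "e \<in> E" for e j
    unfolding N_def
  proof (rule slice_null[OF that, where q = "1 / real m"])
    show A: "A j \<in> sets unit_interval"
      unfolding A_def by (simp add: sets_restrict_space_iff)
    have "emeasure unit_interval (A j) = emeasure lborel (A j)"
      by (rule emeasure_restrict_space) (auto simp: A_def)
    also have "\<dots> \<le> emeasure lborel {real j / real m..(real j + 1) / real m}"
      by (rule emeasure_mono) (auto simp: A_def)
    also have "\<dots> = ennreal (1 / real m)"
      using m by (subst emeasure_lborel_Icc) (auto simp: field_simps)
    finally show "emeasure unit_interval (A j) \<le> ennreal (1 / real m)" .
  qed (use m in \<open>auto simp: m_def field_simps\<close>)
  then have "(\<Union>e\<in>E. \<Union>j. N e j) \<in> null_sets (cdp_space E)"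
    by (intro null_sets_UN' countable_E) auto
  then show ?thesis
  proof (rule AE_I')
    show "{U \<in> space (cdp_space E). \<not> wf (earlier U)} \<subseteq> (\<Union>e\<in>E. \<Union>j. N e j)"
    proof
      fix U assume U: "U \<in> {U \<in> space (cdp_space E). \<not> wf (earlier U)}"
      then obtain s where s: "\<And>i. (s (Suc i), s i) \<in> earlier U"
        by (auto simp: wf_iff_no_infinite_down_chain)
      have sE: "s i \<in> E" and sadj: "s (Suc i) \<in> adj_edges (s i)" for i
        using s[of i] by (auto simp: earlier_def)
      have U01: "U f \<in> {0..1}" if "f \<in> E" for f
        using U that by (auto simp: cdp_space_def space_PiM PiE_iff space_restrict_space)
      have dec: "U (s j) < U (s i)" if "i < j" for i j
        using that
      proof (induction j)
        case (Suc j)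
        have "U (s (Suc j)) < U (s j)" using s[of j] by (simp add: earlier_def)
        then show ?case using Suc by (cases "i = j") auto
      qed simp
      define h where "h i = nat \<lfloor>real m * U (s i)\<rfloor>" for i
      have hdec: "h j \<le> h i" if "i \<le> j" for i j
      proof -
        have "U (s j) \<le> U (s i)" using dec[of i j] that by (cases "i = j") auto
        then show ?thesis unfolding h_def by (intro nat_mono floor_mono mult_left_mono) auto
      qed
      obtain i0 where i0: "\<And>i. h i0 \<le> h i" using ex_has_least_nat[of "\<lambda>_. True" _ h] by blast
      have hc: "h i = h i0" if "i \<ge> i0" for i using i0 hdec that by (meson le_antisym)
      have sA: "U (s i) \<in> A (h i0)" if "i \<ge> i0" for i
      proof -
        have u: "0 \<le> U (s i)" "U (s i) \<le> 1" using U01[OF sE[of i]] by auto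
        have "real (h i) = of_int \<lfloor>real m * U (s i)\<rfloor>"
          unfolding h_def using u m by (intro of_nat_nat) auto
        then have "real (h i) \<le> real m * U (s i)" "real m * U (s i) \<le> real (h i) + 1"
          by linarith+
        then show ?thesis
          using m u unfolding A_def hc[OF that, symmetric] by (auto simp: field_simps)
      qed
      have "inj s" by (rule injI) (metis dec less_irrefl linorder_neqE_nat)
      have "\<exists>p\<in>edge_paths (s i0) n. distinct p \<and> (\<forall>f\<in>set p. U f \<in> A (h i0))" for n
      proof
        show "map s [i0..<Suc (i0 + n)] \<in> edge_paths (s i0) n" by (rule chain_path) (rule sadj)
        show "distinct (map s [i0..<Suc (i0 + n)]) \<and>
          (\<forall>f\<in>set (map s [i0..<Suc (i0 + n)]). U f \<in> A (h i0))"
          using \<open>inj s\<close> sA by (auto simp: distinct_map inj_on_def simp del: upt_Suc)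
      qed
      then have "U \<in> N (s i0) (h i0)" using U by (auto simp: N_def)
      then show "U \<in> (\<Union>e\<in>E. \<Union>j. N e j)" using sE by blast
    qed
  qed
qed

lemma space_cdp: "U \<in> space (cdp_space E) \<Longrightarrow> e \<in> E \<Longrightarrow> U e \<in> {0..1}"
  by (auto simp: cdp_space_def space_PiM PiE_iff space_restrict_space)

lemma AE_unique_cdp_config: "AE U in cdp_space E. \<exists>!\<omega>. is_cdp_config E k U \<omega>"
  using AE_wf_earlier
proof (rule AE_mp, intro AE_I2 impI)
  fix U assume "U \<in> space (cdp_space E)" "wf (earlier U)"
  then show "\<exists>!\<omega>. is_cdp_config E k U \<omega>" using config_if_wf(1) space_cdp by blast
qed

lemma measurable_time:
  assumes "e \<in> E"
  shows "(\<lambda>U. U e) \<in> borel_measurable (cdp_space E)"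
proof -
  have "(\<lambda>U. U e) \<in> measurable (cdp_space E) unit_interval"
    unfolding cdp_space_def by (rule measurable_component_singleton[OF assms])
  then show ?thesis by (simp add: measurable_restrict_space2_iff)
qed

lemma measurable_approx: "Measurable.pred (cdp_space E) (\<lambda>U. approx k n U e)"
proof (induction n arbitrary: e)
  case (Suc n)
  show ?case
  proof (cases "e \<in> E")
    case True
    have "Measurable.pred (cdp_space E)
      (\<lambda>U. int (card {v. v \<noteq> w \<and> {u, v} \<in> E \<and> U {u, v} < U e \<and> approx k n U {u, v}}) < k u)"
      (is "Measurable.pred _ (\<lambda>U. int (card (?S U)) < _)") for u w
    proof -
      have [measurable]: "Measurable.pred (cdp_space E) (\<lambda>U. v \<in> ?S U)" for v
      proof (cases "{u, v} \<in> E")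
        case True
        note [measurable] = measurable_time[OF True] measurable_time[OF \<open>e \<in> E\<close>] Suc
        show ?thesis by simp
      qed simp
      let ?F = "{v. {u, v} \<in> E}"
      have "card (?S U) = (\<Sum>v\<in>?F. if v \<in> ?S U then 1 else 0)" for U
      proof -
        have "?S U = ?F \<inter> {v. v \<in> ?S U}" by blast
        then show ?thesis using finite_nbrs[of u] by (simp only: sum.If_cases) simp
      qed
      then have eq: "(int (card (?S U)) < k u) = (int (\<Sum>v\<in>?F. if v \<in> ?S U then 1 else 0) < k u)" for U
        by (simp only:)
      have [measurable]: "(\<lambda>U. \<Sum>v\<in>?F. if v \<in> ?S U then 1 else 0 :: nat)
        \<in> measurable (cdp_space E) (count_space UNIV)"
        by measurable
      show ?thesis unfolding eq
        by (rule measurable_compose[where g = "\<lambda>n. int n < k u" and N = "count_space UNIV"]) measurable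
    qed
    then have "Measurable.pred (cdp_space E) (\<lambda>U. \<forall>u w. e = {u, w} \<longrightarrow>
      int (card {v. v \<noteq> w \<and> {u, v} \<in> E \<and> U {u, v} < U e \<and> approx k n U {u, v}}) < k u)"
      by measurable
    then show ?thesis using True by (simp add: step_def)
  qed simp
qed simp

lemma percolation_event_measurable:
  "percolation_event E k a t \<in> sets (completion (cdp_space E))"
proof -
  define \<omega> where "\<omega> U e \<longleftrightarrow> t \<in> {0..1} \<and> e \<in> E \<and> U e < t \<and> (\<exists>n. \<forall>m\<ge>n. approx k m U e)" for U e
  have w: "Measurable.pred (cdp_space E) (\<lambda>U. \<omega> U e)" for e
  proof (cases "e \<in> E")
    case True
    note [measurable] = measurable_time[OF True] measurable_approx
    show ?thesis unfolding \<omega>_def by measurable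
  qed (simp add: \<omega>_def)
  have n: "Measurable.pred (cdp_space E) (\<lambda>U. ((\<lambda>x y. {x, y} \<in> E \<and> \<omega> U {x, y}) ^^ n) a x)" for n x
  proof (induction n arbitrary: x)
    case (Suc n)
    note [measurable] = w Suc
    show ?case by (simp add: relcompp_apply)
  qed simp
  have c: "Measurable.pred (cdp_space E) (\<lambda>U. open_connected E (\<omega> U) a x)" for x
    unfolding open_connected_def rtranclp_power using n by measurable
  have inf: "infinite S \<longleftrightarrow> (\<forall>xs. \<exists>x. x \<notin> set xs \<and> x \<in> S)" for S :: "'v set"
  proof
    assume S: "infinite S"
    show "\<forall>xs. \<exists>x. x \<notin> set xs \<and> x \<in> S"
    proof
      fix xs
      have "\<not> S \<subseteq> set xs" using S finite_subset[of S "set xs"] by auto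
      then show "\<exists>x. x \<notin> set xs \<and> x \<in> S" by blast
    qed
  next
    assume F: "\<forall>xs. \<exists>x. x \<notin> set xs \<and> x \<in> S"
    show "infinite S"
    proof
      assume "finite S"
      then obtain xs where "set xs = S" using finite_list by blast
      then show False using F by blast
    qed
  qed
  have "Measurable.pred (cdp_space E) (\<lambda>U. infinite {x. open_connected E (\<omega> U) a x})"
    unfolding inf mem_Collect_eq using c by measurable
  then have m: "{U \<in> space (cdp_space E). infinite {x. open_connected E (\<omega> U) a x}}
      \<in> sets (completion (cdp_space E))" by (simp add: pred_def)
  have eq: "AE U in cdp_space E.
    U \<in> {U \<in> space (cdp_space E). infinite {x. open_connected E (\<omega> U) a x}} \<longleftrightarrow>
    U \<in> percolation_event E k a t"
    using AE_wf_earlier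
  proof (rule AE_mp, intro AE_I2 impI)
    fix U assume U: "U \<in> space (cdp_space E)" "wf (earlier U)"
    then have "\<forall>e\<in>E. U e \<in> {0..1}" using space_cdp by blast
    then have "cdp_config E k U t = \<omega> U"
      using config_if_wf(2)[OF _ U(2)] by (intro ext) (simp add: \<omega>_def)
    then show "U \<in> {U \<in> space (cdp_space E). infinite {x. open_connected E (\<omega> U) a x}} \<longleftrightarrow>
      U \<in> percolation_event E k a t"
      using U by (simp add: percolation_event_def)
  qed
  show ?thesis
    by (rule completion.in_sets_AE[OF AE_completion[OF eq] m]) (auto simp: percolation_event_def)
qed

end

lemma hypercubic_adj: "{x, y} \<in> hypercubic_edges \<longleftrightarrow> (\<Sum>i\<in>UNIV. \<bar>x $ i - y $ i\<bar>) = 1"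
  by (auto simp: hypercubic_edges_def doubleton_eq_iff abs_minus_commute)

lemma bounded_degree_hypercubic:
  "bounded_degree_graph (hypercubic_edges :: (int ^ 'd::finite) set set)
    (card {z :: int ^ 'd. (\<Sum>i\<in>UNIV. \<bar>z $ i\<bar>) = 1})"
proof
  fix e :: "(int ^ 'd) set" assume "e \<in> hypercubic_edges"
  then obtain x y where "e = {x, y}" "(\<Sum>i\<in>UNIV. \<bar>x $ i - y $ i\<bar>) = 1"
    by (auto simp: hypercubic_edges_def)
  moreover from this have "x \<noteq> y" by auto
  ultimately show "\<exists>u w. u \<noteq> w \<and> e = {u, w}" by blast
next
  fix u :: "int ^ 'd"
  let ?Z = "{z :: int ^ 'd. (\<Sum>i\<in>UNIV. \<bar>z $ i\<bar>) = 1}"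
  have "?Z \<subseteq> vec_lambda ` (UNIV \<rightarrow> {-1..1})"
  proof
    fix z assume z: "z \<in> ?Z"
    have "\<bar>z $ i\<bar> \<le> 1" for i
      using z member_le_sum[of i UNIV "\<lambda>i. \<bar>z $ i\<bar>"] by simp
    then have "vec_nth z \<in> UNIV \<rightarrow> {-1..1}" by (simp add: Pi_iff abs_le_iff)
    then show "z \<in> vec_lambda ` (UNIV \<rightarrow> {-1..1})" by (metis imageI vec_nth_inverse)
  qed
  moreover have "finite ((UNIV :: 'd set) \<rightarrow> {-1..1 :: int})"
    using finite_PiE[of "UNIV :: 'd set" "\<lambda>_. {-1..1 :: int}"] by (simp add: PiE_UNIV_domain)
  ultimately have fin: "finite ?Z" by (meson finite_imageI finite_subset)
  have eq: "{v. {u, v} \<in> hypercubic_edges} = (\<lambda>z. u - z) ` ?Z"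
  proof (intro equalityI subsetI)
    fix v assume "v \<in> {v. {u, v} \<in> hypercubic_edges}"
    then have "u - v \<in> ?Z" "v = u - (u - v)" by (simp_all add: hypercubic_adj)
    then show "v \<in> (\<lambda>z. u - z) ` ?Z" by (rule rev_image_eqI)
  next
    fix v assume "v \<in> (\<lambda>z. u - z) ` ?Z"
    then show "v \<in> {v. {u, v} \<in> hypercubic_edges}" by (auto simp: hypercubic_adj)
  qed
  show "finite {v. {u, v} \<in> hypercubic_edges}" unfolding eq using fin by simp
  show "card {v. {u, v} \<in> hypercubic_edges} \<le> card ?Z"
    unfolding eq using fin by (rule card_image_le)
qed

lemma hypercubic_AE_unique_cdp_config:
  "AE U in cdp_space (hypercubic_edges :: (int ^ 'd::finite) set set).
    \<exists>!\<omega>. is_cdp_config hypercubic_edges k U \<omega>"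
  by (rule bounded_degree_graph.AE_unique_cdp_config[OF bounded_degree_hypercubic])

lemma hypercubic_percolation_event_measurable:
  "percolation_event (hypercubic_edges :: (int ^ 'd::finite) set set) k a t
    \<in> sets (completion (cdp_space hypercubic_edges))"
  by (rule bounded_degree_graph.percolation_event_measurable[OF bounded_degree_hypercubic])

end

theory Submission
  imports Defs
begin

text \<open>
  An edge open at time \<open>t\<close> is open at time \<open>1\<close>, so let \<open>t = 1\<close>. The final configuration has degrees at
  most 2, and it is maximal: each closed edge has a saturated endpoint (one of degree 2). Hence an
  infinite cluster is a half-line or a doubly infinite path.

  Mass transport excludes half-lines, since a half-line has one end but infinitely many vertices.

  If there is an infinite cluster, then a finite modification of the configuration which again has
  degrees at most 2 and is maximal contains a half-line: cut an edge and add edges as long as a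
  half-line remains. If the result is not maximal, two half-lines with adjacent ends are left, and one
  edge is rerouted. A finite modification with these properties is the final configuration for all
  times that agree with the given ones except on finitely many edges, closed after the modification,
  where they are close to 1. Resampling finitely many times thus turns an infinite cluster of positive
  probability into a half-line of positive probability, a contradiction.
\<close>

subsection \<open>Clusters in graphs of degree at most 2\<close>

definition cluster :: "'v set set \<Rightarrow> 'v \<Rightarrow> 'v set" where
  "cluster W y = {x. (\<lambda>u v. {u, v} \<in> W)\<^sup>*\<^sup>* y x}"

text \<open>Degree at most 1. Without cardinalities the condition passes to subsets at once and is a
  countable combination of events.\<close>

definition low :: "'v set set \<Rightarrow> 'v \<Rightarrow> bool" where
  "low W v \<longleftrightarrow> (\<forall>a b. {v, a} \<in> W \<longrightarrow> {v, b} \<in> W \<longrightarrow> a = b)"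

definition deg_le2 :: "'v set set \<Rightarrow> bool" where
  "deg_le2 W \<longleftrightarrow> (\<forall>v a b c. {v, a} \<in> W \<longrightarrow> {v, b} \<in> W \<longrightarrow> {v, c} \<in> W \<longrightarrow> a = b \<or> a = c \<or> b = c)"

text \<open>An end of an infinite cluster. In a loop-free \<open>W\<close> of degrees at most 2 the
  cluster is then a one-sided infinite path from \<open>y\<close>.\<close>

definition half_line :: "'v set set \<Rightarrow> 'v \<Rightarrow> bool" where
  "half_line W y \<longleftrightarrow> low W y \<and> infinite (cluster W y)"

lemma lowD: "low W v \<Longrightarrow> {v, a} \<in> W \<Longrightarrow> {v, b} \<in> W \<Longrightarrow> a = b"
  unfolding low_def by blast

lemma not_lowE:
  assumes "\<not> low W v"
  obtains a b where "{v, a} \<in> W" "{v, b} \<in> W" "a \<noteq> b"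
  using assms unfolding low_def by blast

lemma not_lowI: "{v, a} \<in> W \<Longrightarrow> {v, b} \<in> W \<Longrightarrow> a \<noteq> b \<Longrightarrow> \<not> low W v"
  unfolding low_def by blast

lemma deg_le2D:
  "deg_le2 W \<Longrightarrow> {v, a} \<in> W \<Longrightarrow> {v, b} \<in> W \<Longrightarrow> {v, c} \<in> W \<Longrightarrow> a \<noteq> b \<Longrightarrow> c = a \<or> c = b"
  unfolding deg_le2_def by metis

lemma low_subset: "low W v \<Longrightarrow> W' \<subseteq> W \<Longrightarrow> low W' v"
  unfolding low_def by blast

lemma deg_le2_subset: "deg_le2 W \<Longrightarrow> W' \<subseteq> W \<Longrightarrow> deg_le2 W'"
  unfolding deg_le2_def by blast

lemma low_insert_other: "v \<noteq> a \<Longrightarrow> v \<noteq> b \<Longrightarrow> low (insert {a, b} W) v \<longleftrightarrow> low W v"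
  by (simp add: low_def doubleton_eq_iff)

lemma deg_le2_insert:
  assumes "deg_le2 W" "low W a" "low W b" "a \<noteq> b"
  shows "deg_le2 (insert {a, b} W)"
  unfolding deg_le2_def
proof (intro allI impI)
  fix v p q r
  assume *: "{v, p} \<in> insert {a, b} W" "{v, q} \<in> insert {a, b} W" "{v, r} \<in> insert {a, b} W"
  have ins: "{v, x} \<in> insert {a, b} W \<longleftrightarrow> v = a \<and> x = b \<or> v = b \<and> x = a \<or> {v, x} \<in> W" for x
    by (simp add: doubleton_eq_iff disj_assoc)
  consider "v = a" | "v = b" | "v \<noteq> a" "v \<noteq> b" by blast
  then show "p = q \<or> p = r \<or> q = r"
  proof cases
    case 3
    then show ?thesis using * assms(1) unfolding ins deg_le2_def by metis
  qed (use * assms(2-4) in \<open>unfold ins low_def, metis\<close>)+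
qed

lemma cluster_refl [simp]: "y \<in> cluster W y"
  by (simp add: cluster_def)

lemma cluster_step: "x \<in> cluster W y \<Longrightarrow> {x, z} \<in> W \<Longrightarrow> z \<in> cluster W y"
  by (auto simp: cluster_def intro: rtranclp.rtrancl_into_rtrancl)

lemma cluster_trans: "x \<in> cluster W y \<Longrightarrow> z \<in> cluster W x \<Longrightarrow> z \<in> cluster W y"
  by (auto simp: cluster_def)

lemma cluster_sym:
  assumes "x \<in> cluster W y" shows "y \<in> cluster W x"
proof -
  have "symp (\<lambda>u v. {u, v} \<in> W)" by (auto intro: sympI simp: insert_commute)
  then have "symp (\<lambda>u v. {u, v} \<in> W)\<^sup>*\<^sup>*" by (rule symp_rtranclp)
  then show ?thesis using assms by (auto simp: cluster_def dest: sympD)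
qed

lemma cluster_eq: "x \<in> cluster W y \<Longrightarrow> cluster W x = cluster W y"
  by (auto intro: cluster_trans dest: cluster_sym)

lemma cluster_least:
  assumes "y \<in> S" "\<And>u v. u \<in> S \<Longrightarrow> {u, v} \<in> W \<Longrightarrow> v \<in> S"
  shows "cluster W y \<subseteq> S"
proof
  fix x assume "x \<in> cluster W y"
  then have "(\<lambda>u v. {u, v} \<in> W)\<^sup>*\<^sup>* y x" by (simp add: cluster_def)
  then show "x \<in> S" by induction (use assms in auto)
qed

text \<open>Only edges at the cluster of \<open>y\<close> have to survive, so changes of
  \<open>W\<close> elsewhere do not matter.\<close>

lemma cluster_local_mono:
  assumes "\<And>u v. u \<in> cluster W y \<Longrightarrow> {u, v} \<in> W \<Longrightarrow> {u, v} \<in> W'"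
  shows "cluster W y \<subseteq> cluster W' y"
proof -
  have "cluster W y \<subseteq> cluster W y \<inter> cluster W' y"
    by (rule cluster_least) (use assms in \<open>auto intro: cluster_step\<close>)
  then show ?thesis by blast
qed

lemma cluster_mono: "W \<subseteq> W' \<Longrightarrow> cluster W y \<subseteq> cluster W' y"
  by (rule cluster_local_mono) blast

section \<open>Structure of a cluster seen from one of its ends\<close>

definition path_to :: "'v set set \<Rightarrow> 'v \<Rightarrow> nat \<Rightarrow> (nat \<Rightarrow> 'v) \<Rightarrow> bool" where
  "path_to W y n h \<longleftrightarrow> h 0 = y \<and> inj_on h {..n} \<and> (\<forall>i<n. {h i, h (Suc i)} \<in> W)"

text \<open>Predecessor and successor already exhaust the degree of an inner vertex, and the end
  \<open>y\<close> has at most one edge; so a path from an end never branches.\<close>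

lemma path_nbr:
  assumes W: "deg_le2 W" "low W y" and h: "path_to W y n h" and i: "i < n" and a: "{h i, a} \<in> W"
  shows "a = h (Suc i) \<or> (\<exists>j. i = Suc j \<and> a = h j)"
proof (cases i)
  case 0
  then show ?thesis using W(2) h a i unfolding path_to_def by (auto dest: lowD)
next
  case (Suc j)
  have "h j \<noteq> h (Suc i)"
    using h i Suc unfolding path_to_def by (auto dest!: inj_onD[where x = j and y = "Suc i"])
  moreover have "{h i, h j} \<in> W" "{h i, h (Suc i)} \<in> W"
    using h i Suc unfolding path_to_def by (auto simp: insert_commute)
  ultimately show ?thesis using deg_le2D[OF W(1) _ _ a] Suc by blast
qed

lemma path_in_cluster: "path_to W y n h \<Longrightarrow> i \<le> n \<Longrightarrow> h i \<in> cluster W y"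
proof (induction i)
  case (Suc i)
  then have "h i \<in> cluster W y" "{h i, h (Suc i)} \<in> W" by (simp_all add: path_to_def)
  then show ?case by (rule cluster_step)
qed (simp add: path_to_def)

text \<open>Walk from \<open>y\<close> without branching. Either the walk gets stuck, and its
  vertices are the whole cluster, or it goes on forever. The last clause treats the trivial path: an
  isolated \<open>y\<close> stays low even after receiving one edge.\<close>

lemma cluster_from_end:
  assumes W: "deg_le2 W" "low W y" and loop: "\<And>v. {v, v} \<notin> W"
  obtains (ray) g where "inj g" "g 0 = y" "\<And>i. {g i, g (Suc i)} \<in> W" "cluster W y = range g"
  | (finite_path) h n where "path_to W y n h" "cluster W y = h ` {..n}" "low W (h n)"
      "n = 0 \<Longrightarrow> (\<forall>a. {y, a} \<notin> W)"
proof (cases "\<exists>h n. path_to W y n h \<and> (\<forall>a. {h n, a} \<in> W \<longrightarrow> a \<in> h ` {..n})")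
  case True
  then obtain h n where h: "path_to W y n h" and cl: "\<And>a. {h n, a} \<in> W \<Longrightarrow> a \<in> h ` {..n}" by blast
  have "cluster W y \<subseteq> h ` {..n}"
  proof (rule cluster_least)
    show "y \<in> h ` {..n}" using h by (auto simp: path_to_def)
    fix u v assume "u \<in> h ` {..n}" "{u, v} \<in> W"
    then obtain i where i: "i \<le> n" "{h i, v} \<in> W" by auto
    show "v \<in> h ` {..n}"
    proof (cases "i = n")
      case False
      then show ?thesis using path_nbr[OF W h _ i(2)] i(1) by auto
    qed (use cl i in blast)
  qed
  then have c: "cluster W y = h ` {..n}" using path_in_cluster[OF h] by auto
  \<comment> \<open>Seen from the neighbour \<open>a\<close>, the vertex \<open>h n\<close> has to
    be the successor on the path, so \<open>a\<close> is the predecessor of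
    \<open>h n\<close>.\<close>
  have nb: "\<exists>i. n = Suc i \<and> a = h i" if "{h n, a} \<in> W" for a
  proof -
    have "a \<in> h ` {..n}" using that by (rule cl)
    then obtain i where i: "i \<le> n" "a = h i" by auto
    have "i \<noteq> n" using loop that i by auto
    then have "i < n" "{h i, h n} \<in> W" using i that by (auto simp: insert_commute)
    then have "h n = h (Suc i) \<or> (\<exists>j. i = Suc j \<and> h n = h j)" using path_nbr[OF W h] by blast
    moreover have "h n = h j \<Longrightarrow> n = j" if "j \<le> n" for j
      using that h by (auto simp: path_to_def dest!: inj_onD[where x = n and y = j])
    ultimately have "n = Suc i" using \<open>i < n\<close> by (metis Suc_leI Suc_lessD less_imp_le less_irrefl)
    then show ?thesis using i by blast
  qed
  have "low W (h n)" unfolding low_def using nb by blast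
  moreover have "\<forall>a. {y, a} \<notin> W" if "n = 0" using nb that h by (auto simp: path_to_def)
  ultimately show ?thesis using finite_path[OF h c] by blast
next
  case False
  \<comment> \<open>Each path is prolonged by a new vertex and keeps its earlier ones, so the
    diagonal \<open>g\<close> below is the limit path.\<close>
  have "\<exists>f. \<forall>n. path_to W y n (f n) \<and> (\<forall>i\<le>n. f (Suc n) i = f n i)"
  proof (rule dependent_nat_choice)
    show "\<exists>h. path_to W y 0 h" by (rule exI[of _ "\<lambda>_. y"]) (simp add: path_to_def)
  next
    fix h n assume h: "path_to W y n h"
    then obtain a where a: "{h n, a} \<in> W" "a \<notin> h ` {..n}" using False by blast
    have "path_to W y (Suc n) (h(Suc n := a))"
      using h a unfolding path_to_def by (auto simp: atMost_Suc less_Suc_eq inj_on_def)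
    then show "\<exists>h'. path_to W y (Suc n) h' \<and> (\<forall>i\<le>n. h' i = h i)"
      by (intro exI[of _ "h(Suc n := a)"]) auto
  qed
  then obtain f where f: "\<And>n. path_to W y n (f n)" "\<And>n i. i \<le> n \<Longrightarrow> f (Suc n) i = f n i" by blast
  define g where "g n = f n n" for n
  have fg: "f n i = g i" if "i \<le> n" for n i
    using that by (induction n) (auto simp: g_def le_Suc_eq f(2))
  have g: "path_to W y n g" for n
    using f(1)[of n] fg[of _ n] unfolding path_to_def by (auto simp: inj_on_def)
  have "inj g"
  proof (rule injI)
    fix i j assume "g i = g j"
    then show "i = j" using g[of "max i j"] by (auto simp: path_to_def dest: inj_onD)
  qed
  moreover have "g 0 = y" "\<And>i. {g i, g (Suc i)} \<in> W" using g unfolding path_to_def by auto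
  moreover have "cluster W y \<subseteq> range g"
  proof (rule cluster_least)
    show "y \<in> range g" using \<open>g 0 = y\<close> by auto
    fix u v assume "u \<in> range g" "{u, v} \<in> W"
    then obtain i where "{g i, v} \<in> W" by auto
    then show "v \<in> range g" using path_nbr[OF W g[of "Suc i"]] by blast
  qed
  moreover have "range g \<subseteq> cluster W y" using path_in_cluster[OF g] by auto
  ultimately show ?thesis using ray by blast
qed

lemma half_line_ray:
  assumes "deg_le2 W" "half_line W y" "\<And>v. {v, v} \<notin> W"
  obtains g where "inj g" "g 0 = y" "\<And>i. {g i, g (Suc i)} \<in> W" "cluster W y = range g"
proof -
  have "low W y" "infinite (cluster W y)" using assms(2) by (auto simp: half_line_def)
  then show thesis
    using cluster_from_end[OF assms(1) _ assms(3), of y thesis] that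
    by (metis finite_atMost finite_imageI)
qed

text \<open>All vertices of the ray except the first have two distinct neighbours.\<close>

lemma half_line_end_unique:
  assumes W: "deg_le2 W" "\<And>v. {v, v} \<notin> W" and y: "half_line W y"
    and z: "z \<in> cluster W y" "low W z"
  shows "z = y"
proof -
  obtain g where g: "inj g" "g 0 = y" "\<And>i. {g i, g (Suc i)} \<in> W" "cluster W y = range g"
    using half_line_ray[OF W(1) y W(2)] by metis
  obtain i where i: "z = g i" using z g by auto
  show ?thesis
  proof (cases i)
    case (Suc j)
    then have "g j = g (Suc i)"
      using lowD[OF z(2), of "g j" "g (Suc i)"] g(3)[of j] g(3)[of i] i by (auto simp: insert_commute)
    then show ?thesis using injD[OF g(1)] Suc by fastforce
  qed (use g i in simp)
qed

subsection \<open>Finite modifications\<close>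

context bounded_degree_graph
begin

text \<open>Edges that can join \<open>W\<close> while degrees stay at most 2;
  \<open>addable W = {}\<close> is maximality.\<close>

definition addable :: "'v set set \<Rightarrow> 'v set set" where
  "addable W = {e \<in> E - W. \<forall>v\<in>e. low W v}"

definition near :: "'v set set \<Rightarrow> 'v set set \<Rightarrow> bool" where
  "near W0 W \<longleftrightarrow> W \<subseteq> E \<and> deg_le2 W \<and> finite (W0 - W \<union> (W - W0))"

lemma no_loop: "{v, v} \<notin> E"
  using simple[of "{v, v}"] by (auto simp: doubleton_eq_iff)

lemma no_loop_subset: "W \<subseteq> E \<Longrightarrow> {v, v} \<notin> W"
  using no_loop by blast

text \<open>Nothing is addable to \<open>W0\<close>, so an edge addable to \<open>W\<close> meets a
  changed edge, and bounded degree leaves finitely many such edges.\<close>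

lemma finite_addable:
  assumes W0: "W0 \<subseteq> E" "addable W0 = {}" and W: "near W0 W"
  shows "finite (addable W)"
proof (rule finite_subset)
  let ?S = "W0 - W \<union> (W - W0)"
  show "addable W \<subseteq> (\<Union>f\<in>?S. adj_edges f)"
  proof
    fix e assume e: "e \<in> addable W"
    then have eE: "e \<in> E" "e \<notin> W" "\<forall>v\<in>e. low W v" by (auto simp: addable_def)
    show "e \<in> (\<Union>f\<in>?S. adj_edges f)"
    proof (cases "e \<in> W0")
      case True
      then show ?thesis using eE simple[of e] by (intro UN_I[of e]) (auto simp: adj_edges_def)
    next
      case False
      then obtain v where v: "v \<in> e" "\<not> low W0 v" using W0 eE by (auto simp: addable_def)
      then obtain a b where ab: "{v, a} \<in> W0" "{v, b} \<in> W0" "a \<noteq> b" by (rule_tac not_lowE)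
      have "{v, a} \<notin> W \<or> {v, b} \<notin> W" using eE(3) v ab lowD by metis
      then obtain c where "{v, c} \<in> W0 - W" using ab by blast
      then show ?thesis using v eE by (intro UN_I[of "{v, c}"]) (auto simp: adj_edges_def)
    qed
  qed
  show "finite (\<Union>f\<in>?S. adj_edges f)"
    using W W0 by (intro finite_UN_I adj_edges_bound(1)) (auto simp: near_def)
qed

lemma addable_psubset:
  assumes "e \<in> addable W" shows "addable (insert e W) \<subset> addable W"
proof -
  have "addable (insert e W) \<subseteq> addable W"
    using low_subset[of "insert e W" _ W] by (auto simp: addable_def)
  moreover have "e \<notin> addable (insert e W)" by (auto simp: addable_def)
  ultimately show ?thesis using assms by blast
qed

lemma near_insert:
  assumes "near W0 W" "e \<in> addable W" shows "near W0 (insert e W)"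
proof -
  have e: "e \<in> E" "\<forall>v\<in>e. low W v" using assms by (auto simp: addable_def)
  then obtain a b where ab: "a \<noteq> b" "e = {a, b}" using simple by blast
  have "deg_le2 (insert e W)" unfolding ab
    using assms(1) e ab by (intro deg_le2_insert) (auto simp: near_def)
  moreover have "finite (W0 - insert e W \<union> (insert e W - W0))"
    by (rule finite_subset[of _ "insert e (W0 - W \<union> (W - W0))"]) (use assms(1) in \<open>auto simp: near_def\<close>)
  ultimately show ?thesis using assms(1) e by (auto simp: near_def)
qed

text \<open>Every addition makes the finite set \<open>addable\<close> strictly smaller, so at the
  least possible size no addition preserves \<open>P\<close>.\<close>

lemma minimal_addable:
  assumes W0: "W0 \<subseteq> E" "addable W0 = {}" and W: "near W0 W" "P W"
  obtains W' where "near W0 W'" "P W'" "\<And>e. e \<in> addable W' \<Longrightarrow> \<not> P (insert e W')"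
proof -
  obtain W' where W': "near W0 W'" "P W'"
    and m: "\<And>V. near W0 V \<Longrightarrow> P V \<Longrightarrow> card (addable W') \<le> card (addable V)"
    using ex_has_least_nat[of "\<lambda>V. near W0 V \<and> P V" W "\<lambda>V. card (addable V)"] W by blast
  have "\<not> P (insert e W')" if "e \<in> addable W'" for e
    using m[OF near_insert[OF W'(1) that]] psubset_card_mono[OF finite_addable[OF W0 W'(1)] addable_psubset[OF that]]
    by linarith
  then show thesis using that W' by blast
qed

text \<open>An end all of whose neighbours are saturated survives every completion.\<close>

definition sealed :: "'v set set \<Rightarrow> 'v \<Rightarrow> bool" where
  "sealed W y \<longleftrightarrow> half_line W y \<and> (\<forall>z. {y, z} \<in> E \<longrightarrow> \<not> low W z)"

lemma complete_sealed:
  assumes W0: "W0 \<subseteq> E" "addable W0 = {}" and W: "near W0 W" "sealed W y"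
  obtains W' where "near W0 W'" "addable W' = {}" "half_line W' y"
proof -
  obtain W' where W': "near W0 W'" "sealed W' y" "\<And>e. e \<in> addable W' \<Longrightarrow> \<not> sealed (insert e W') y"
    using minimal_addable[OF W0 W(1), of "\<lambda>V. sealed V y"] W(2) by blast
  have "sealed (insert e W') y" if e: "e \<in> addable W'" for e
  proof -
    have e': "e \<in> E" "\<forall>v\<in>e. low W' v" using e by (auto simp: addable_def)
    then obtain a b where ab: "a \<noteq> b" "e = {a, b}" using simple by blast
    \<comment> \<open>The neighbours of \<open>y\<close> are saturated, so no addable edge contains
      \<open>y\<close>.\<close>
    have "y \<noteq> a" "y \<noteq> b" using e' ab W'(2) by (auto simp: sealed_def insert_commute)
    then show ?thesis
      using W'(2) cluster_mono[of W' "insert e W'" y] low_subset[of "insert e W'" _ W'] ab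
      by (auto simp: sealed_def half_line_def low_insert_other dest: finite_subset)
  qed
  then have "addable W' = {}" using W'(3) by blast
  then show thesis using that W' by (simp add: sealed_def)
qed

end

lemma half_line_edge:
  assumes "half_line W y"
  obtains a where "{y, a} \<in> W"
proof -
  have "\<exists>a. {y, a} \<in> W"
  proof (rule ccontr)
    assume "\<nexists>a. {y, a} \<in> W"
    then have "cluster W y \<subseteq> {y}" by (intro cluster_least) auto
    then show False using assms by (auto simp: half_line_def dest: finite_subset)
  qed
  then show thesis using that by blast
qed

text \<open>If \<open>v\<close> has two edges, removing one makes both its endpoints low and leaves
  an infinite piece at one of them.\<close>

lemma half_line_cut:
  assumes W: "deg_le2 W" "\<And>v. {v, v} \<notin> W" and inf: "infinite (cluster W v)"
  obtains W' y where "W' \<subseteq> W" "finite (W - W')" "half_line W' y"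
proof (cases "low W v")
  case True
  then show thesis using that[of W v] inf by (simp add: half_line_def)
next
  case False
  then obtain a b where ab: "{v, a} \<in> W" "{v, b} \<in> W" "a \<noteq> b" by (rule not_lowE)
  define W' where "W' = W - {{v, a}}"
  have low: "low W' v" "low W' a"
  proof -
    show "low W' v" unfolding low_def W'_def
      using deg_le2D[OF W(1) ab(1,2) _ ab(3)] by auto
    show "low W' a" unfolding low_def
    proof (intro allI impI)
      fix c d assume "{a, c} \<in> W'" "{a, d} \<in> W'"
      then have "c \<noteq> v" "d \<noteq> v" "{a, c} \<in> W" "{a, d} \<in> W" "{a, v} \<in> W"
        using ab by (auto simp: W'_def insert_commute)
      then show "c = d" using W(1) by (metis deg_le2D)
    qed
  qed
  have "cluster W v \<subseteq> cluster W' v \<union> cluster W' a"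
  proof (rule cluster_least)
    fix p q assume p: "p \<in> cluster W' v \<union> cluster W' a" "{p, q} \<in> W"
    show "q \<in> cluster W' v \<union> cluster W' a"
    proof (cases "{p, q} = {v, a}")
      case False
      then have "{p, q} \<in> W'" using p by (simp add: W'_def)
      then show ?thesis using p by (auto intro: cluster_step)
    qed (auto simp: doubleton_eq_iff)
  qed simp
  then have "infinite (cluster W' v) \<or> infinite (cluster W' a)"
    using inf finite_subset by blast
  then obtain y where "half_line W' y" using low by (auto simp: half_line_def)
  then show thesis using that[of W' y] by (auto simp: W'_def intro: finite_subset[of _ "{{v, a}}"])
qed

subsection \<open>Surgery on an infinite cluster\<close>

text \<open>In familiar terms: minimum degree 3, no triangle and no K_{2,3}.\<close>

locale surgery_graph = bounded_degree_graph E D for E :: "'v::countable set set" and D +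
  assumes third_nbr: "\<exists>c. {v, c} \<in> E \<and> c \<noteq> a \<and> c \<noteq> b"
    and triangle_free: "{u, v} \<in> E \<Longrightarrow> {v, w} \<in> E \<Longrightarrow> {u, w} \<notin> E"
    and common_nbrs: "u \<noteq> v \<Longrightarrow> {u, p} \<in> E \<Longrightarrow> {v, p} \<in> E \<Longrightarrow> {u, q} \<in> E \<Longrightarrow> {v, q} \<in> E \<Longrightarrow>
      {u, r} \<in> E \<Longrightarrow> {v, r} \<in> E \<Longrightarrow> p = q \<or> p = r \<or> q = r"
begin

text \<open>Saturate \<open>x\<close> by the edge \<open>xw\<close>, and free \<open>w\<close> for this by removing \<open>ww'\<close>.\<close>

definition switch :: "'v set set \<Rightarrow> 'v \<Rightarrow> 'v \<Rightarrow> 'v \<Rightarrow> 'v set set" where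
  "switch W x w w' = insert {x, w} (W - {{w, w'}})"

text \<open>The end \<open>y\<close> gets no new edge, and \<open>x\<close> becomes saturated by
  \<open>xw\<close> next to its half-line edge. The other neighbours of \<open>y\<close> lose
  nothing: \<open>w\<close> is not adjacent to \<open>y\<close>, as there are no triangles, and
  \<open>w'\<close> is not by assumption.\<close>

lemma sealed_switch:
  assumes W: "near W0 W" and xy: "{x, y} \<in> E" "{x, y} \<notin> W" and y: "low W y" and x: "half_line W x"
    and full: "\<And>z. {y, z} \<in> E \<Longrightarrow> z \<noteq> x \<Longrightarrow> \<not> low W z"
    and w: "{x, w} \<in> E" "{x, w} \<notin> W" "w \<noteq> y" "{w, w'} \<in> W" "{y, w'} \<notin> E"
    and inf: "infinite (cluster (switch W x w w') y)"
  shows "near W0 (switch W x w w')" and "sealed (switch W x w w') y"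
proof -
  note sw = switch_def[of W x w w']
  have WE: "W \<subseteq> E" and d2: "deg_le2 W" using W by (auto simp: near_def)
  have ne: "x \<noteq> y" "x \<noteq> w" "w \<noteq> w'" "w' \<noteq> x" "w' \<noteq> y"
    using xy w no_loop WE triangle_free[OF w(1), of y] by (auto simp: insert_commute)
  have lowx: "low W x" using x by (simp add: half_line_def)
  have "low (W - {{w, w'}}) w" unfolding low_def
    using d2 w(4) by (metis Diff_iff deg_le2D insertI1)
  then have "deg_le2 (switch W x w w')" unfolding sw
    using ne lowx d2 by (intro deg_le2_insert) (auto intro: low_subset deg_le2_subset)
  moreover have "finite (W0 - switch W x w w' \<union> (switch W x w w' - W0))"
    by (rule finite_subset[of _ "{{x, w}, {w, w'}} \<union> (W0 - W \<union> (W - W0))"])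
      (use W in \<open>auto simp: near_def sw\<close>)
  ultimately show "near W0 (switch W x w w')" using WE w by (auto simp: near_def sw)
  have "low (switch W x w w') y"
    unfolding sw using y ne w by (subst low_insert_other) (auto intro: low_subset)
  moreover have "\<not> low (switch W x w w') z" if z: "{y, z} \<in> E" for z
  proof (cases "z = x")
    case True
    obtain a where a: "{x, a} \<in> W" using x by (rule half_line_edge)
    then have "{x, a} \<in> switch W x w w'" "{x, w} \<in> switch W x w w'"
      using ne by (auto simp: sw doubleton_eq_iff)
    moreover have "a \<noteq> w" using a w by blast
    ultimately show ?thesis using True not_lowI by metis
  next
    case False
    have "z \<noteq> w" using triangle_free[OF w(1), of y] xy z by (auto simp: insert_commute)
    moreover have "z \<noteq> w'" using z w by blast
    obtain a b where ab: "{z, a} \<in> W" "{z, b} \<in> W" "a \<noteq> b" using full[OF z False] by (rule not_lowE)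
    then have "{z, a} \<in> switch W x w w'" "{z, b} \<in> switch W x w w'"
      using \<open>z \<noteq> w\<close> \<open>z \<noteq> w'\<close> by (auto simp: sw doubleton_eq_iff)
    then show ?thesis using ab(3) by (rule not_lowI)
  qed
  ultimately show "sealed (switch W x w w') y" using inf by (simp add: sealed_def half_line_def)
qed

text \<open>The only removed edge contains \<open>w\<close>.\<close>

lemma cluster_switch:
  assumes "w \<notin> cluster W y" shows "cluster W y \<subseteq> cluster (switch W x w w') y"
proof (rule cluster_local_mono)
  fix u v assume uv: "u \<in> cluster W y" "{u, v} \<in> W"
  then have "u \<noteq> w" "v \<noteq> w" using assms cluster_step by metis+
  then show "{u, v} \<in> switch W x w w'" using uv by (auto simp: switch_def doubleton_eq_iff)
qed

text \<open>
  A switch at \<open>x\<close> seals \<open>y\<close>, unless the neighbour \<open>w\<close> of \<open>x\<close> lies on the half-line of \<open>y\<close> and its successor is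
  adjacent to \<open>y\<close>; then a switch at \<open>y\<close> with this successor seals \<open>x\<close>.
\<close>

lemma sealed_from_adjacent_ends:
  assumes W: "near W0 W" and xy: "{x, y} \<in> E" "{x, y} \<notin> W" and hl: "half_line W x" "half_line W y"
    and dis: "x \<notin> cluster W y"
    and full_y: "\<And>z. {y, z} \<in> E \<Longrightarrow> z \<noteq> x \<Longrightarrow> \<not> low W z"
    and full_x: "\<And>z. {x, z} \<in> E \<Longrightarrow> z \<noteq> y \<Longrightarrow> \<not> low W z"
  obtains W' z where "near W0 W'" "sealed W' z"
proof -
  have WE: "W \<subseteq> E" and d2: "deg_le2 W" using W by (auto simp: near_def)
  have nl: "{v, v} \<notin> W" for v using WE by (rule no_loop_subset)
  have low: "low W x" "low W y" and inf: "infinite (cluster W x)" "infinite (cluster W y)"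
    using hl by (auto simp: half_line_def)
  obtain p where p: "{x, p} \<in> W" using hl(1) by (rule half_line_edge)
  \<comment> \<open>The only open edge at \<open>x\<close> is \<open>xp\<close>, so
    \<open>xw\<close> is closed.\<close>
  obtain w where w: "{x, w} \<in> E" "w \<noteq> y" "w \<noteq> p" using third_nbr by blast
  have xw: "{x, w} \<notin> W" using lowD[OF low(1) p] w by blast
  have fw: "\<not> low W w" using full_x w by blast
  show thesis
  proof (cases "w \<in> cluster W y")
    case False
    obtain a b where ab: "{w, a} \<in> W" "{w, b} \<in> W" "a \<noteq> b" using fw by (rule not_lowE)
    have "a \<noteq> x" "b \<noteq> x" using ab xw by (auto simp: insert_commute)
    \<comment> \<open>\<open>w\<close> and \<open>y\<close> already share the neighbour
      \<open>x\<close>, so they cannot also share both \<open>a\<close> and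
      \<open>b\<close>.\<close>
    then have "{y, a} \<notin> E \<or> {y, b} \<notin> E"
      using common_nbrs[of w y x a b] ab w xy WE by (auto simp: insert_commute)
    then obtain w' where w': "{w, w'} \<in> W" "{y, w'} \<notin> E" using ab by blast
    have "infinite (cluster (switch W x w w') y)"
      by (rule infinite_super[OF cluster_switch[OF False] inf(2)])
    then show thesis
      using sealed_switch[OF W xy low(2) hl(1) full_y w(1) xw w(2) w'] that by blast
  next
    case True
    obtain g where g: "inj g" "g 0 = y" "\<And>i. {g i, g (Suc i)} \<in> W" "cluster W y = range g"
      using half_line_ray[OF d2 hl(2) nl] by metis
    obtain i where i: "w = g i" using True g by auto
    have i0: "i \<noteq> 0" using i g(2) w(2) by metis
    show thesis
    proof (cases "{y, g (Suc i)} \<in> E")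
      case False
      let ?W = "switch W x w (g (Suc i))"
      \<comment> \<open>The removed edge follows \<open>w\<close> on the ray, so the segment from
        \<open>y\<close> to \<open>w\<close> survives and leads through \<open>xw\<close> into the
        infinite cluster of \<open>x\<close>.\<close>
      have "g j \<in> cluster ?W y" if "j \<le> i" for j
        using that
      proof (induction j)
        case (Suc j)
        have "{g j, g (Suc j)} \<in> ?W"
          using Suc.prems g(3)[of j] i by (auto simp: switch_def doubleton_eq_iff inj_eq[OF g(1)])
        then show ?case using Suc by (auto intro: cluster_step)
      qed (simp add: g)
      then have "w \<in> cluster ?W y" using i by blast
      moreover have "{w, x} \<in> ?W" by (simp add: switch_def insert_commute)
      ultimately have "x \<in> cluster ?W y" by (rule cluster_step)
      then have "cluster ?W x \<subseteq> cluster ?W y" using cluster_trans by fast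
      moreover have "w \<notin> cluster W x" using True dis by (metis cluster_sym cluster_trans)
      then have "cluster W x \<subseteq> cluster ?W x" by (rule cluster_switch)
      ultimately have "infinite (cluster ?W y)" using inf(1) by (meson infinite_super)
      note sealed_switch[OF W xy low(2) hl(1) full_y w(1) xw w(2) _ False this]
      then show thesis using g(3)[of i] i by (intro that) simp_all
    next
      case True': True
      let ?w = "g (Suc i)" and ?v = "g (Suc (Suc i))"
      let ?W = "switch W y ?w ?v"
      have yx: "{y, x} \<in> E" "{y, x} \<notin> W" using xy by (auto simp: insert_commute)
      have wx: "?w \<noteq> x" using dis g(4) by auto
      have yw: "{y, ?w} \<notin> W"
        using lowD[OF low(2), of "g 1" ?w] g(2) g(3)[of 0] i0 injD[OF g(1), of 1 "Suc i"] by auto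
      \<comment> \<open>\<open>x\<close> and \<open>?w\<close> already have the common neighbours
        \<open>y\<close> and \<open>w\<close>, so \<open>?v\<close> cannot be a third one.\<close>
      have "{x, ?v} \<notin> E"
      proof
        assume "{x, ?v} \<in> E"
        moreover have "{?w, w} \<in> E" "{?w, ?v} \<in> E" using g(3)[of i] g(3)[of "Suc i"] i WE
          by (auto simp: insert_commute)
        moreover have "w \<noteq> ?v" "?v \<noteq> y" using i injD[OF g(1), of i "Suc (Suc i)"]
          injD[OF g(1), of "Suc (Suc i)" 0] g(2) by auto
        ultimately show False
          using common_nbrs[of ?w x y w ?v] wx True' xy w by (auto simp: insert_commute)
      qed
      moreover have "?w \<notin> cluster W x" using dis g(4) by (metis cluster_sym cluster_trans rangeI)
      then have "infinite (cluster ?W x)" by (rule infinite_super[OF cluster_switch inf(1)])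
      ultimately have sw: "{x, ?v} \<notin> E" "infinite (cluster ?W x)" by blast+
      show thesis
        by (rule that) (rule sealed_switch[OF W yx low(1) hl(2) full_x True' yw wx g(3) sw]; assumption)+
    qed
  qed
qed

lemma exists_near_half_line:
  assumes W0: "W0 \<subseteq> E" "deg_le2 W0" "addable W0 = {}" and inf: "infinite (cluster W0 v)"
  obtains W y where "near W0 W" "addable W = {}" "half_line W y"
proof -
  obtain W1 y1 where W1: "W1 \<subseteq> W0" "finite (W0 - W1)" "half_line W1 y1"
    using half_line_cut[OF W0(2) no_loop_subset[OF W0(1)] inf] by metis
  have "near W0 W1" using W1 W0 by (auto simp: near_def deg_le2_subset Diff_eq_empty_iff[THEN iffD2])
  moreover have "\<exists>y. half_line W1 y" using W1(3) by blast
  ultimately obtain W where W: "near W0 W" "\<exists>y. half_line W y"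
    and min': "\<And>e. e \<in> addable W \<Longrightarrow> \<not> (\<exists>y. half_line (insert e W) y)"
    by (rule minimal_addable[OF W0(1,3), of W1 "\<lambda>V. \<exists>y. half_line V y"]) (rule that; assumption)
  have min: "\<not> half_line (insert e W) y" if "e \<in> addable W" for e y
    using min'[OF that] by blast
  have WE: "W \<subseteq> E" and d2: "deg_le2 W" using W by (auto simp: near_def)
  have nl: "{v, v} \<notin> W" for v using WE by (rule no_loop_subset)
  obtain y where y: "half_line W y" using W by blast
  \<comment> \<open>An addable edge avoiding the end \<open>z\<close> would leave \<open>z\<close>
    the end of a half-line, against \<open>min\<close>.\<close>
  have keep: "z \<in> e" if e: "e \<in> addable W" and z: "half_line W z" for z e
  proof (rule ccontr)
    assume "z \<notin> e"
    moreover obtain a b where "e = {a, b}" using simple[of e] e unfolding addable_def by blast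
    ultimately have "low (insert e W) z" using z by (simp add: half_line_def low_insert_other)
    moreover have "infinite (cluster (insert e W) z)"
      using z infinite_super[OF cluster_mono[of W "insert e W"]] by (auto simp: half_line_def)
    ultimately show False using min[OF e] by (auto simp: half_line_def)
  qed
  show thesis
  proof (cases "addable W = {}")
    case True
    then show thesis using that W y by blast
  next
    case False
    then obtain e where e: "e \<in> addable W" by blast
    then have e': "e \<in> E" "e \<notin> W" "\<And>v. v \<in> e \<Longrightarrow> low W v" by (auto simp: addable_def)
    obtain x where ex: "e = {x, y}" "x \<noteq> y"
      using simple[OF e'(1)] keep[OF e y] by auto
    have lowx: "low W x" using e' ex by blast
    \<comment> \<open>Otherwise the cluster of \<open>x\<close> is a finite path, and adding
      \<open>e\<close> would lengthen the half-line of \<open>y\<close> to one ending at the far end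
      \<open>z\<close> of this path.\<close>
    have "infinite (cluster W x)"
    proof
      assume fin: "finite (cluster W x)"
      have yx: "y \<notin> cluster W x" using fin y cluster_eq by (metis half_line_def)
      obtain z where z: "z \<in> cluster W x" "low W z" "z = x \<Longrightarrow> (\<forall>a. {x, a} \<notin> W)"
      proof (rule cluster_from_end[OF d2 lowx nl])
        fix g :: "nat \<Rightarrow> 'v" assume "inj g" "cluster W x = range g"
        then show thesis using fin by (simp add: finite_image_iff)
      next
        fix h n assume h: "path_to W x n h" "cluster W x = h ` {..n}" "low W (h n)"
          "n = 0 \<Longrightarrow> (\<forall>a. {x, a} \<notin> W)"
        have "h n = x \<Longrightarrow> n = 0" using h(1) by (auto simp: path_to_def dest!: inj_onD[where x = n and y = 0])
        then show thesis using that[of "h n"] h by auto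
      qed
      have "low (insert e W) z"
      proof (cases "z = x")
        case True
        then show ?thesis using z(3) ex by (auto simp: low_def doubleton_eq_iff)
      next
        case False
        then show ?thesis using z yx ex by (metis low_insert_other)
      qed
      moreover have "infinite (cluster (insert e W) z)"
      proof -
        have "x \<in> cluster (insert e W) z" using cluster_sym[OF z(1)] cluster_mono[of W "insert e W" z] by blast
        then have "y \<in> cluster (insert e W) z" using cluster_step ex by (metis insertI1)
        then have "cluster (insert e W) z = cluster (insert e W) y" using cluster_eq by metis
        then show ?thesis using y infinite_super[OF cluster_mono[of W "insert e W" y]]
          by (auto simp: half_line_def)
      qed
      ultimately show False using min[OF e] by (auto simp: half_line_def)
    qed
    then have x: "half_line W x" using lowx by (simp add: half_line_def)
    have dis: "x \<notin> cluster W y" using half_line_end_unique[OF d2 nl y] lowx ex by blast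
    \<comment> \<open>If \<open>az\<close> is open, a low \<open>z\<close> would be a second end on
      the half-line of \<open>a\<close>; if it is closed, it would be an addable edge missing the
      end \<open>b\<close>.\<close>
    have full: "\<not> low W z" if ab: "{a, z} \<in> E" "z \<noteq> b" "half_line W a" "half_line W b" "a \<noteq> b" for a b z
    proof
      assume l: "low W z"
      show False
      proof (cases "{a, z} \<in> W")
        case True
        then have "z \<in> cluster W a" using cluster_step cluster_refl by metis
        then show False using half_line_end_unique[OF d2 nl ab(3) _ l] True nl by auto
      next
        case False
        then have "{a, z} \<in> addable W" using ab l by (auto simp: addable_def half_line_def)
        then show False using keep[OF _ ab(4)] ab by blast
      qed
    qed
    obtain W' z where "near W0 W'" "sealed W' z"
      using sealed_from_adjacent_ends[OF W(1) _ _ x y dis] full[OF _ _ x y] full[OF _ _ y x] ex e' by metis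
    then show thesis using complete_sealed[OF W0(1,3)] that by metis
  qed
qed

end

subsection \<open>Realising a modified configuration\<close>

context bounded_degree_graph
begin

text \<open>The configuration at time 1 as the explicit limit of \<open>approx\<close>: measurable
  before completion, and equal to \<open>cdp_config\<close> for regular times.\<close>

definition conf :: "('v set \<Rightarrow> real) \<Rightarrow> 'v set set" where
  "conf U = {e \<in> E. U e < 1 \<and> (\<exists>n. \<forall>m\<ge>n. approx (\<lambda>_. 2) m U e)}"

definition regular :: "('v set \<Rightarrow> real) \<Rightarrow> bool" where
  "regular U \<longleftrightarrow> (\<forall>e\<in>E. U e \<in> {0..1} \<and> U e < 1) \<and> inj_on U E \<and> wf (earlier U)"

text \<open>The negation of \<open>step\<close> for restriction 2, with the cardinality replaced by
  two witnesses.\<close>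

definition blocked :: "('v set \<Rightarrow> real) \<Rightarrow> 'v set set \<Rightarrow> 'v set \<Rightarrow> bool" where
  "blocked U W e \<longleftrightarrow> (\<exists>u w a b. e = {u, w} \<and> a \<noteq> b \<and> a \<noteq> w \<and> b \<noteq> w \<and>
     {u, a} \<in> W \<and> {u, b} \<in> W \<and> U {u, a} < U e \<and> U {u, b} < U e)"

lemma step_iff_not_blocked:
  assumes "W \<subseteq> E"
  shows "step (\<lambda>_. 2) U (\<lambda>e. e \<in> W) e \<longleftrightarrow> \<not> blocked U W e"
proof -
  define S where "S u w = {v. v \<noteq> w \<and> {u, v} \<in> E \<and> U {u, v} < U e \<and> {u, v} \<in> W}" for u w
  have c: "int (card (S u w)) < 2 \<longleftrightarrow> (\<forall>a\<in>S u w. \<forall>b\<in>S u w. a = b)" for u w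
  proof -
    have "finite (S u w)" unfolding S_def by (rule finite_subset[OF _ finite_nbrs[of u]]) blast
    moreover have "int (card (S u w)) < 2 \<longleftrightarrow> card (S u w) \<le> Suc 0" by linarith
    ultimately show ?thesis by (simp only: card_le_Suc0_iff_eq)
  qed
  have "step (\<lambda>_. 2) U (\<lambda>e. e \<in> W) e \<longleftrightarrow> (\<forall>u w. e = {u, w} \<longrightarrow> int (card (S u w)) < 2)"
    by (simp only: step_def S_def)
  then have "step (\<lambda>_. 2) U (\<lambda>e. e \<in> W) e \<longleftrightarrow>
      (\<forall>u w. e = {u, w} \<longrightarrow> (\<forall>a\<in>S u w. \<forall>b\<in>S u w. a = b))"
    by (simp only: c)
  moreover have S: "(a \<in> S u w) \<longleftrightarrow> a \<noteq> w \<and> {u, a} \<in> W \<and> U {u, a} < U e" for a u w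
    using assms by (auto simp: S_def)
  ultimately show ?thesis unfolding blocked_def Ball_def S by blast
qed

lemma conf_eq_cdp_config:
  assumes "regular U"
  shows "conf U = {e \<in> E. cdp_config E (\<lambda>_. 2) U 1 e}"
proof -
  have "cdp_config E (\<lambda>_. 2) U 1 e \<longleftrightarrow>
      1 \<in> {0..1::real} \<and> e \<in> E \<and> U e < 1 \<and> (\<exists>n. \<forall>m\<ge>n. approx (\<lambda>_. 2) m U e)" for e
    using assms by (intro config_if_wf(2)) (simp_all add: regular_def)
  then show ?thesis by (auto simp: conf_def)
qed

text \<open>For regular times the recursion has a unique solution, so checking the local rule is
  enough to identify the configuration.\<close>

lemma conf_eq_iff:
  assumes U: "regular U" and W: "W \<subseteq> E"
  shows "conf U = W \<longleftrightarrow> (\<forall>e\<in>E. e \<in> W \<longleftrightarrow> \<not> blocked U W e)"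
proof
  have U01: "\<forall>e\<in>E. U e \<in> {0..1}" and U1: "\<And>e. e \<in> E \<Longrightarrow> U e < 1" and wf: "wf (earlier U)"
    using U by (auto simp: regular_def)
  note ex1 = config_if_wf(1)[OF U01 wf, of "\<lambda>_. 2"]
  {
    assume c: "conf U = W"
    have "is_cdp_config E (\<lambda>_. 2) U (cdp_config E (\<lambda>_. 2) U)"
      unfolding cdp_config_def by (rule theI'[OF ex1])
    then obtain A where A: "\<And>t e. cdp_config E (\<lambda>_. 2) U t e \<longleftrightarrow> t \<in> {0..1} \<and> e \<in> E \<and> U e < t \<and> A e"
      "\<And>e. A e \<longleftrightarrow> e \<in> E \<and> step (\<lambda>_. 2) U A e"
      unfolding config_step[OF U01] by blast
    have "A = (\<lambda>e. e \<in> W)"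
      using A(1)[of 1] A(2) U1 unfolding c[symmetric] conf_eq_cdp_config[OF U] by auto
    then show "\<forall>e\<in>E. e \<in> W \<longleftrightarrow> \<not> blocked U W e"
      using A(2) step_iff_not_blocked[OF W] by simp
  }
  assume e: "\<forall>e\<in>E. e \<in> W \<longleftrightarrow> \<not> blocked U W e"
  define \<omega> where "\<omega> = (\<lambda>t e. t \<in> {0..1} \<and> e \<in> E \<and> U e < t \<and> e \<in> W)"
  have "is_cdp_config E (\<lambda>_. 2) U \<omega>"
    unfolding config_step[OF U01]
  proof (intro exI conjI allI)
    show "\<omega> t e \<longleftrightarrow> t \<in> {0..1} \<and> e \<in> E \<and> U e < t \<and> e \<in> W" for t e by (simp add: \<omega>_def)
    show "e \<in> W \<longleftrightarrow> e \<in> E \<and> step (\<lambda>_. 2) U (\<lambda>e. e \<in> W) e" for e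
      using e W step_iff_not_blocked[OF W] by blast
  qed
  then have "cdp_config E (\<lambda>_. 2) U = \<omega>"
    unfolding cdp_config_def by (rule the1_equality[OF ex1])
  then show "conf U = W"
    unfolding conf_eq_cdp_config[OF U] using W U1 by (auto simp: \<omega>_def)
qed

lemma conf_subset: "conf U \<subseteq> E"
  by (auto simp: conf_def)

lemma conf_not_blocked:
  assumes "regular U" "e \<in> E" shows "e \<in> conf U \<longleftrightarrow> \<not> blocked U (conf U) e"
  using conf_eq_iff[OF assms(1) conf_subset] assms(2) by blast

text \<open>Times are distinct, so among three open edges at a vertex one is the latest, and the
  other two would have blocked it.\<close>

lemma deg_le2_conf:
  assumes U: "regular U" shows "deg_le2 (conf U)"
  unfolding deg_le2_def
proof (intro allI impI)
  fix v a b c assume abc: "{v, a} \<in> conf U" "{v, b} \<in> conf U" "{v, c} \<in> conf U"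
  have last: "\<not> (U {v, p} < U {v, r} \<and> U {v, q} < U {v, r})"
    if "p \<noteq> q" "p \<noteq> r" "q \<noteq> r" "{v, p} \<in> conf U" "{v, q} \<in> conf U" "{v, r} \<in> conf U" for p q r
  proof -
    have "{v, r} \<in> E" using that conf_subset by blast
    then have "\<not> blocked U (conf U) {v, r}" using conf_not_blocked[OF U] that by blast
    then show ?thesis unfolding blocked_def using that by blast
  qed
  have ne: "U {v, p} \<noteq> U {v, q}" if "p \<noteq> q" "{v, p} \<in> conf U" "{v, q} \<in> conf U" for p q
  proof -
    have "{v, p} \<noteq> {v, q}" using that(1) by (auto simp: doubleton_eq_iff)
    moreover have "inj_on U E" using U by (simp add: regular_def)
    ultimately show ?thesis using that(2,3) conf_subset by (meson inj_onD subsetD)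
  qed
  show "a = b \<or> a = c \<or> b = c"
  proof (rule ccontr)
    assume "\<not> (a = b \<or> a = c \<or> b = c)"
    then have d: "a \<noteq> b" "a \<noteq> c" "b \<noteq> c" "b \<noteq> a" "c \<noteq> a" "c \<noteq> b" by auto
    show False
      using last[OF d(1,2,3) abc] last[OF d(2,1,6) abc(1,3,2)] last[OF d(3,4,5) abc(2,3,1)]
        ne[OF d(1) abc(1,2)] ne[OF d(2) abc(1,3)] ne[OF d(3) abc(2,3)] by linarith
  qed
qed

lemma addable_conf:
  assumes "regular U" shows "addable (conf U) = {}"
proof -
  have "\<exists>v\<in>e. \<not> low (conf U) v" if "e \<in> E" "e \<notin> conf U" for e
  proof -
    have "blocked U (conf U) e" using conf_not_blocked[OF assms] that by blast
    then obtain u w a b where "e = {u, w}" "a \<noteq> b" "{u, a} \<in> conf U" "{u, b} \<in> conf U"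
      unfolding blocked_def by blast
    then show ?thesis using not_lowI[of u a "conf U" b] by blast
  qed
  then show ?thesis by (auto simp: addable_def)
qed

text \<open>
  To turn \<open>conf U\<close> into \<open>W\<close>, delay the edges that are closed in \<open>W\<close> and adjacent to a modified edge
  until their saturated endpoints have received both of their open edges.
\<close>

lemma conf_modification:
  assumes U: "regular U" and W: "near (conf U) W" "addable W = {}"
  obtains F and n :: nat where "finite F" "F \<subseteq> E"
    "\<forall>V. regular V \<and> (\<forall>e. e \<notin> F \<longrightarrow> V e = U e) \<and> (\<forall>e\<in>F. 1 - 1 / real (Suc n) < V e) \<longrightarrow> conf V = W"
proof -
  define S where "S = conf U - W \<union> (W - conf U)"
  have WE: "W \<subseteq> E" and d2: "deg_le2 W" and finS: "finite S" using W by (auto simp: near_def S_def)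
  have SE: "S \<subseteq> E" using WE conf_subset by (auto simp: S_def)
  \<comment> \<open>An edge is adjacent to itself, so \<open>F\<close> contains the removed edges,
    while edges of \<open>W\<close> keep their times.\<close>
  define F where "F = (\<Union>f\<in>S. adj_edges f) - W"
  have finF: "finite F" unfolding F_def
    using finS SE by (intro finite_Diff finite_UN_I adj_edges_bound(1)) auto
  have FE: "F \<subseteq> E" by (auto simp: F_def adj_edges_def)
  \<comment> \<open>Open edges that have to precede the delayed ones: finitely many times below 1,
    so a threshold fits above them.\<close>
  define T where "T = (\<Union>f\<in>F. adj_edges f) \<inter> W"
  have finT: "finite T" unfolding T_def
    using finF FE by (intro finite_Int disjI1 finite_UN_I adj_edges_bound(1)) auto
  have "\<exists>m. \<forall>e\<in>T. U e < m \<and> m < (1::real)"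
  proof (cases "T = {}")
    case False
    have "Max (U ` T) < 1" using finT False WE U by (auto simp: regular_def T_def)
    then obtain m where m: "Max (U ` T) < m" "m < 1" using dense by blast
    have "U e < m" if "e \<in> T" for e
    proof -
      have "U e \<le> Max (U ` T)" using finT that by simp
      then show ?thesis using m by linarith
    qed
    then show ?thesis using m by blast
  qed auto
  then obtain m where "\<And>e. e \<in> T \<Longrightarrow> U e < m \<and> m < 1" by blast
  \<comment> \<open>Thresholds \<open>1 - 1 / Suc n\<close> are countably many, so that later a
    single null set serves them all.\<close>
  define n where "n = nat \<lceil>1 / (1 - m)\<rceil>"
  have n: "U e < 1 - 1 / real (Suc n)" if "e \<in> T" for e
  proof -
    have m: "U e < m" "m < 1" using \<open>\<And>e. e \<in> T \<Longrightarrow> U e < m \<and> m < 1\<close>[OF that] by auto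
    have "1 / (1 - m) \<le> real (Suc n)" unfolding n_def by linarith
    then have "1 / real (Suc n) \<le> 1 - m" using m by (simp add: field_simps)
    then show ?thesis using m by linarith
  qed
  have "conf V = W"
    if V: "regular V" "\<And>e. e \<notin> F \<Longrightarrow> V e = U e" "\<And>e. e \<in> F \<Longrightarrow> 1 - 1 / real (Suc n) < V e" for V
  proof -
    have VW: "V e = U e" if "e \<in> W" for e using V(2) that by (simp add: F_def)
    \<comment> \<open>Blocking would require three edges of \<open>W\<close> at one vertex.\<close>
    have "\<not> blocked V W e" if e: "e \<in> W" for e
    proof
      assume "blocked V W e"
      then obtain u w a b where b: "e = {u, w}" "a \<noteq> b" "a \<noteq> w" "b \<noteq> w" "{u, a} \<in> W" "{u, b} \<in> W"
        unfolding blocked_def by blast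
      then show False using d2 e deg_le2D by metis
    qed
    \<comment> \<open>Maximality gives a saturated endpoint; its two edges lie in \<open>T\<close>
      and thus come before the delayed \<open>e\<close>.\<close>
    moreover have "blocked V W e" if e: "e \<in> E" "e \<notin> W" "e \<in> F" for e
    proof -
      obtain u where u: "u \<in> e" "\<not> low W u" using W(2) e by (auto simp: addable_def)
      obtain w where w: "e = {u, w}" using simple[OF e(1)] u(1) by auto
      obtain a b where ab: "{u, a} \<in> W" "{u, b} \<in> W" "a \<noteq> b" using u(2) by (rule not_lowE)
      have "{u, c} \<in> T" if "{u, c} \<in> W" for c
        unfolding T_def using that e w WE by (auto simp: adj_edges_def intro!: UN_I[of e])
      then have "V {u, c} < V e" if "{u, c} \<in> W" for c
        using n[of "{u, c}"] V(3)[OF e(3)] VW that by fastforce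
      moreover have "a \<noteq> w" "b \<noteq> w" using ab e w by auto
      ultimately show ?thesis unfolding blocked_def using ab w by blast
    qed
    \<comment> \<open>No changed edge meets \<open>e\<close>, so \<open>e\<close> was closed before
      and is blocked by the same edges at unchanged times.\<close>
    moreover have "blocked V W e" if e: "e \<in> E" "e \<notin> W" "e \<notin> F" for e
    proof -
      have nS: "f \<notin> S" if "f \<inter> e \<noteq> {}" for f
        using e that by (auto simp: F_def adj_edges_def)
      have "e \<noteq> {}" using simple e by blast
      then have "e \<notin> conf U" using nS[of e] e by (auto simp: S_def)
      then have "blocked U (conf U) e" using conf_not_blocked[OF U] e by blast
      then obtain u w a b where b: "e = {u, w}" "a \<noteq> b" "a \<noteq> w" "b \<noteq> w" "{u, a} \<in> conf U" "{u, b} \<in> conf U"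
        "U {u, a} < U e" "U {u, b} < U e"
        unfolding blocked_def by blast
      have "{u, a} \<in> W" "{u, b} \<in> W" using nS[of "{u, a}"] nS[of "{u, b}"] b by (auto simp: S_def)
      then have "V {u, a} < V e" "V {u, b} < V e" using VW V(2)[OF e(3)] b by auto
      then show ?thesis unfolding blocked_def using b(1-4) \<open>{u, a} \<in> W\<close> \<open>{u, b} \<in> W\<close> by blast
    qed
    ultimately show ?thesis unfolding conf_eq_iff[OF V(1) WE] by blast
  qed
  then show thesis by (intro that[OF finF FE, of n]) blast
qed

subsection \<open>Resampling finitely many times\<close>

sublocale cdp: prob_space "cdp_space E"
  unfolding cdp_space_def by (intro prob_space_PiM prob_unit_interval)

lemma distr_resample:
  assumes "e \<in> E"
  shows "(\<lambda>(U, u). U(e := u)) \<in> cdp_space E \<Otimes>\<^sub>M unit_interval \<rightarrow>\<^sub>M cdp_space E"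
    and "distr (cdp_space E \<Otimes>\<^sub>M unit_interval) (cdp_space E) (\<lambda>(U, u). U(e := u)) = cdp_space E"
proof -
  interpret unit: prob_space unit_interval by (rule prob_unit_interval)
  interpret pair_sigma_finite unit_interval "cdp_space E" ..
  \<comment> \<open>Hence the law of a product extended by the coordinate \<open>e\<close> also
    describes overwriting the old time by a fresh one.\<close>
  have E: "insert e E = E" using assms by blast
  have "(\<lambda>(u, X). X(e := u)) \<in> unit_interval \<Otimes>\<^sub>M Pi\<^sub>M E (\<lambda>_. unit_interval) \<rightarrow>\<^sub>M Pi\<^sub>M (insert e E) (\<lambda>_. unit_interval)"
    by measurable
  then have m: "(\<lambda>(u, X). X(e := u)) \<in> unit_interval \<Otimes>\<^sub>M cdp_space E \<rightarrow>\<^sub>M cdp_space E"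
    unfolding E by (simp add: cdp_space_def)
  have c: "(\<lambda>(U, u). U(e := u)) = (\<lambda>(u, X). X(e := u)) \<circ> (\<lambda>(x, y). (y, x))"
    by (auto simp: fun_eq_iff)
  show "(\<lambda>(U, u). U(e := u)) \<in> cdp_space E \<Otimes>\<^sub>M unit_interval \<rightarrow>\<^sub>M cdp_space E"
    unfolding c by (rule measurable_comp[OF measurable_pair_swap' m])
  have "cdp_space E = distr (unit_interval \<Otimes>\<^sub>M cdp_space E) (cdp_space E) (\<lambda>(u, X). X(e := u))"
    using distr_pair_PiM_eq_PiM[of E "\<lambda>_. unit_interval" e] prob_unit_interval
    unfolding E by (simp add: cdp_space_def)
  also have "\<dots> = distr (cdp_space E \<Otimes>\<^sub>M unit_interval) (cdp_space E) (\<lambda>(U, u). U(e := u))"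
    unfolding c by (subst distr_pair_swap) (rule distr_distr[OF m measurable_pair_swap'])
  finally show "distr (cdp_space E \<Otimes>\<^sub>M unit_interval) (cdp_space E) (\<lambda>(U, u). U(e := u)) = cdp_space E" ..
qed

lemma AE_resample:
  assumes "e \<in> E" and \<phi>: "AE U in cdp_space E. \<phi> U"
  shows "AE U in cdp_space E. AE u in unit_interval. \<phi> (U(e := u))"
proof -
  interpret unit: prob_space unit_interval by (rule prob_unit_interval)
  interpret pair_sigma_finite "cdp_space E" unit_interval ..
  have "AE U in distr (cdp_space E \<Otimes>\<^sub>M unit_interval) (cdp_space E) (\<lambda>(U, u). U(e := u)). \<phi> U"
    unfolding distr_resample(2)[OF assms(1)] by (rule \<phi>)
  then have "AE p in cdp_space E \<Otimes>\<^sub>M unit_interval. \<phi> ((\<lambda>(U, u). U(e := u)) p)"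
    by (rule AE_distrD[OF distr_resample(1)[OF assms(1)]])
  then show ?thesis using AE_pair by fastforce
qed

lemma exists_late_time:
  assumes "AE u in unit_interval. P u" "0 \<le> s" "s < 1"
  shows "\<exists>u>s. P u"
proof (rule ccontr)
  assume "\<not> (\<exists>u>s. P u)"
  then have "AE u in unit_interval. u \<notin> {s<..1}" using assms(1) by (auto elim: eventually_mono)
  moreover have S: "{s<..1} \<in> sets unit_interval"
    using assms by (auto simp: sets_restrict_space_iff)
  ultimately have "emeasure unit_interval {s<..1} = 0"
    using AE_iff_null_sets[OF S] by (simp add: null_sets_def)
  moreover have "emeasure unit_interval {s<..1} = emeasure lborel {s<..1}"
    using assms by (intro emeasure_restrict_space) auto
  ultimately show False using assms by simp
qed

text \<open>Resample the edges of \<open>F\<close> one by one: almost every new time is good and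
  late times have positive probability, so some time is both.\<close>

lemma AE_make_late:
  assumes "finite F" "F \<subseteq> E" and \<phi>: "AE U in cdp_space E. \<phi> U" and s: "0 \<le> s" "s < 1"
  shows "AE U in cdp_space E. \<exists>V. (\<forall>e. e \<notin> F \<longrightarrow> V e = U e) \<and> (\<forall>e\<in>F. s < V e) \<and> \<phi> V"
  using assms(1,2)
proof (induction F)
  case empty
  have "(\<forall>e. V e = U e) \<longleftrightarrow> V = U" for U V :: "'v set \<Rightarrow> real" by auto
  then show ?case using \<phi> by simp
next
  case (insert f F)
  let ?\<psi> = "\<lambda>U. \<exists>V. (\<forall>e. e \<notin> F \<longrightarrow> V e = U e) \<and> (\<forall>e\<in>F. s < V e) \<and> \<phi> V"
  have f: "f \<in> E" using insert.prems by blast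
  have "AE U in cdp_space E. ?\<psi> U" using insert by blast
  from AE_resample[OF f this] show ?case
  proof (rule AE_mp, intro AE_I2 impI)
    fix U assume "AE u in unit_interval. ?\<psi> (U(f := u))"
    from exists_late_time[OF this s] obtain u V where
      *: "s < u" "\<And>e. e \<notin> F \<Longrightarrow> V e = (U(f := u)) e" "\<And>e. e \<in> F \<Longrightarrow> s < V e" "\<phi> V" by blast
    have "V f = u" using *(2)[of f] insert.hyps by simp
    moreover have "V e = U e" if "e \<notin> insert f F" for e using *(2)[of e] that by simp
    ultimately show "\<exists>V. (\<forall>e. e \<notin> insert f F \<longrightarrow> V e = U e) \<and> (\<forall>e\<in>insert f F. s < V e) \<and> \<phi> V"
      using * by (intro exI[of _ V]) auto
  qed
qed

text \<open>A resampled time at \<open>e\<close> almost surely avoids the single value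
  \<open>U f\<close>.\<close>

lemma AE_times_distinct:
  assumes e: "e \<in> E" and f: "f \<in> E" and "e \<noteq> f"
  shows "AE U in cdp_space E. U e \<noteq> U f"
proof -
  interpret unit: prob_space unit_interval by (rule prob_unit_interval)
  interpret pair_sigma_finite "cdp_space E" unit_interval ..
  note [measurable] = measurable_time[OF e] measurable_time[OF f] distr_resample(1)[OF e]
  have "AE p in cdp_space E \<Otimes>\<^sub>M unit_interval. case p of (U, u) \<Rightarrow> u \<noteq> U f"
  proof (rule AE_pair_measure)
    have [measurable]: "(\<lambda>u. u) \<in> unit_interval \<rightarrow>\<^sub>M borel"
      by (rule measurable_restrict_space1) simp
    show "{p \<in> space (cdp_space E \<Otimes>\<^sub>M unit_interval). case p of (U, u) \<Rightarrow> u \<noteq> U f}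
        \<in> sets (cdp_space E \<Otimes>\<^sub>M unit_interval)"
      by measurable
    have "AE u in unit_interval. u \<noteq> c" for c
    proof -
      have "AE u in lborel. u \<in> {0..1::real} \<longrightarrow> u \<noteq> c" using AE_lborel_singleton[of c] by eventually_elim simp
      then show ?thesis by (subst AE_restrict_space_iff) auto
    qed
    then show "AE U in cdp_space E. AE u in unit_interval. case (U, u) of (U, u) \<Rightarrow> u \<noteq> U f" by simp
  qed
  then have "AE p in cdp_space E \<Otimes>\<^sub>M unit_interval. (\<lambda>U. U e \<noteq> U f) ((\<lambda>(U, u). U(e := u)) p)"
    using assms(3) by (auto simp: case_prod_unfold)
  moreover have "{U \<in> space (cdp_space E). U e \<noteq> U f} \<in> sets (cdp_space E)"
    by (rule borel_measurable_neq[OF measurable_time[OF e] measurable_time[OF f]])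
  ultimately have "AE U in distr (cdp_space E \<Otimes>\<^sub>M unit_interval) (cdp_space E) (\<lambda>(U, u). U(e := u)). U e \<noteq> U f"
    by (simp only: AE_distr_iff[OF distr_resample(1)[OF e]])
  then show ?thesis unfolding distr_resample(2)[OF e] .
qed

lemma AE_regular: "AE U in cdp_space E. regular U"
proof -
  have "AE U in cdp_space E. U e < 1" if "e \<in> E" for e
  proof -
    have "AE u in lborel. u \<in> {0..1::real} \<longrightarrow> u < 1" using AE_lborel_singleton[of 1] by eventually_elim auto
    then have "AE u in unit_interval. u < 1" by (subst AE_restrict_space_iff) auto
    then show ?thesis unfolding cdp_space_def
      using prob_unit_interval that by (intro AE_PiM_component) auto
  qed
  then have "AE U in cdp_space E. \<forall>e\<in>E. U e < 1" by (simp add: AE_ball_countable countable_E)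
  moreover have "AE U in cdp_space E. \<forall>e\<in>E. \<forall>f\<in>E. e \<noteq> f \<longrightarrow> U e \<noteq> U f"
    using AE_times_distinct by (simp add: AE_ball_countable countable_E)
  moreover have "AE U in cdp_space E. \<forall>e\<in>E. U e \<in> {0..1}" using space_cdp by (intro AE_I2) blast
  ultimately show ?thesis using AE_wf_earlier
    by eventually_elim (auto simp: regular_def inj_on_def)
qed

section \<open>Measurability of cluster events\<close>

lemma measurable_conf [measurable]: "Measurable.pred (cdp_space E) (\<lambda>U. e \<in> conf U)"
proof (cases "e \<in> E")
  case True
  note [measurable] = measurable_time[OF True] measurable_approx
  show ?thesis unfolding conf_def by measurable
qed (simp add: conf_def)

lemma measurable_cluster [measurable]: "Measurable.pred (cdp_space E) (\<lambda>U. x \<in> cluster (conf U) y)"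
proof -
  have "Measurable.pred (cdp_space E) (\<lambda>U. ((\<lambda>u v. {u, v} \<in> conf U) ^^ n) y x)" for n x
    by (induction n arbitrary: x) (simp_all add: relcompp_apply)
  then show ?thesis unfolding cluster_def rtranclp_power mem_Collect_eq by measurable
qed

lemma measurable_half_line [measurable]: "Measurable.pred (cdp_space E) (\<lambda>U. half_line (conf U) y)"
proof -
  \<comment> \<open>Lists are countably many, so infinitude becomes a countable combination of
    events.\<close>
  have inf: "infinite S \<longleftrightarrow> (\<forall>xs. \<exists>x. x \<notin> set xs \<and> x \<in> S)" for S :: "'v set"
    by (metis finite_list finite_set infinite_super subsetI)
  show ?thesis unfolding half_line_def low_def inf by measurable
qed

lemma measurable_deg_le2 [measurable]: "Measurable.pred (cdp_space E) (\<lambda>U. deg_le2 (conf U))"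
  unfolding deg_le2_def by measurable

end

subsection \<open>Translation invariance\<close>

locale translation_invariant_graph = surgery_graph E D
  for E :: "'v::{countable, ab_group_add} set set" and D +
  assumes translate: "{a + u, a + w} \<in> E \<longleftrightarrow> {u, w} \<in> E"
begin

lemma translate_edge: "(+) a ` e \<in> E \<longleftrightarrow> e \<in> E"
proof
  assume "(+) a ` e \<in> E"
  then obtain x y where "(+) a ` e = {x, y}" using simple by blast
  then have "(+) (- a) ` (+) a ` e = {- a + x, - a + y}" by simp
  then have "e = {- a + x, - a + y}" by (simp add: image_image)
  moreover have "{a + (- a + x), a + (- a + y)} \<in> E"
    using \<open>(+) a ` e \<in> E\<close> \<open>(+) a ` e = {x, y}\<close> by (simp add: algebra_simps)
  ultimately show "e \<in> E" using translate by metis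
next
  assume "e \<in> E"
  then obtain x y where "e = {x, y}" using simple by blast
  then show "(+) a ` e \<in> E" using translate \<open>e \<in> E\<close> by simp
qed

text \<open>The restriction to \<open>E\<close> keeps the shifted times in the product space, whose
  elements are \<open>undefined\<close> off \<open>E\<close>.\<close>

definition shift :: "'v \<Rightarrow> ('v set \<Rightarrow> real) \<Rightarrow> 'v set \<Rightarrow> real" where
  "shift a U = (\<lambda>e\<in>E. U ((+) a ` e))"

definition shift_set :: "'v \<Rightarrow> 'v set set \<Rightarrow> 'v set set" where
  "shift_set a W = {e. (+) a ` e \<in> W}"

lemma shift_set_iff: "{u, w} \<in> shift_set a W \<longleftrightarrow> {a + u, a + w} \<in> W"
  by (simp add: shift_set_def)

lemma blocked_shift:
  assumes W: "W \<subseteq> E" and e: "e \<in> E"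
  shows "blocked (shift a U) (shift_set a W) e \<longleftrightarrow> blocked U W ((+) a ` e)"
proof -
  have sh: "shift a U {u, v} = U {a + u, a + v}" if "{a + u, a + v} \<in> W" for u v
    using that W translate by (auto simp: shift_def)
  have she: "shift a U e = U ((+) a ` e)" using e by (simp add: shift_def)
  show ?thesis
  proof
    assume "blocked (shift a U) (shift_set a W) e"
    then obtain u w p q where *: "e = {u, w}" "p \<noteq> q" "p \<noteq> w" "q \<noteq> w"
      "{a + u, a + p} \<in> W" "{a + u, a + q} \<in> W"
      "shift a U {u, p} < shift a U e" "shift a U {u, q} < shift a U e"
      unfolding blocked_def shift_set_iff by blast
    show "blocked U W ((+) a ` e)"
      unfolding blocked_def
      by (rule exI[of _ "a + u"], rule exI[of _ "a + w"], rule exI[of _ "a + p"], rule exI[of _ "a + q"])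
        (use * sh[OF *(5)] sh[OF *(6)] she in simp)
  next
    assume "blocked U W ((+) a ` e)"
    then obtain u w p q where *: "(+) a ` e = {u, w}" "p \<noteq> q" "p \<noteq> w" "q \<noteq> w"
      "{u, p} \<in> W" "{u, q} \<in> W" "U {u, p} < U ((+) a ` e)" "U {u, q} < U ((+) a ` e)"
      unfolding blocked_def by blast
    have "(+) (- a) ` (+) a ` e = {- a + u, - a + w}" using *(1) by simp
    then have e': "e = {- a + u, - a + w}" by (simp add: image_image)
    show "blocked (shift a U) (shift_set a W) e"
      unfolding blocked_def shift_set_iff
      by (rule exI[of _ "- a + u"], rule exI[of _ "- a + w"], rule exI[of _ "- a + p"], rule exI[of _ "- a + q"])
        (use * e' sh[of "- a + u" "- a + p"] sh[of "- a + u" "- a + q"] she in simp)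
  qed
qed

lemma approx_subset: "{e. approx k n U e} \<subseteq> E"
  by (cases n) auto

text \<open>In the form of \<open>blocked\<close>, a step depends only on incidences and comparisons
  of times, and both carry over under translation.\<close>

lemma approx_shift:
  "approx (\<lambda>_. 2) n (shift a U) e \<longleftrightarrow> approx (\<lambda>_. 2) n U ((+) a ` e)"
proof (induction n arbitrary: e)
  case 0
  then show ?case by (simp add: translate_edge)
next
  case (Suc n)
  let ?W = "{e. approx (\<lambda>_. 2) n U e}"
  have W: "{e. approx (\<lambda>_. 2) n (shift a U) e} = shift_set a ?W"
    using Suc by (simp add: shift_set_def)
  have "step (\<lambda>_. 2) (shift a U) (approx (\<lambda>_. 2) n (shift a U)) e \<longleftrightarrow>
      step (\<lambda>_. 2) U (approx (\<lambda>_. 2) n U) ((+) a ` e)" if "e \<in> E"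
    using step_iff_not_blocked[of "{e. approx (\<lambda>_. 2) n (shift a U) e}" "shift a U" e, OF approx_subset]
      step_iff_not_blocked[of ?W U "(+) a ` e", OF approx_subset]
      blocked_shift[of ?W e a U, OF approx_subset that]
    unfolding W[symmetric] by simp
  then show ?case by (auto simp: translate_edge)
qed

lemma conf_shift: "conf (shift a U) = shift_set a (conf U)"
  by (auto simp: conf_def shift_set_def approx_shift translate_edge) (auto simp: shift_def)

lemma cluster_shift: "x \<in> cluster (shift_set a W) y \<longleftrightarrow> a + x \<in> cluster W (a + y)"
proof -
  have "cluster (shift_set a W) y \<subseteq> {x. a + x \<in> cluster W (a + y)}"
    by (rule cluster_least) (auto simp: shift_set_iff intro: cluster_step)
  moreover have "cluster W (a + y) \<subseteq> {z. - a + z \<in> cluster (shift_set a W) y}"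
    by (rule cluster_least) (auto simp: shift_set_iff intro: cluster_step)
  ultimately show ?thesis by force
qed

lemma half_line_shift: "half_line (shift_set a W) y \<longleftrightarrow> half_line W (a + y)"
proof -
  have "low (shift_set a W) y \<longleftrightarrow> low W (a + y)"
    unfolding low_def shift_set_iff by (metis add.commute add_right_cancel diff_add_cancel)
  moreover have "cluster W (a + y) = (+) a ` cluster (shift_set a W) y"
  proof (intro equalityI subsetI)
    fix z assume "z \<in> cluster W (a + y)"
    then have "z - a \<in> cluster (shift_set a W) y" by (simp add: cluster_shift)
    then show "z \<in> (+) a ` cluster (shift_set a W) y" by (rule rev_image_eqI) simp
  qed (auto simp: cluster_shift)
  then have "finite (cluster W (a + y)) \<longleftrightarrow> finite (cluster (shift_set a W) y)"
    by (simp add: finite_image_iff)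
  ultimately show ?thesis by (simp add: half_line_def)
qed

lemma deg_le2_shift: "deg_le2 (shift_set a W) \<longleftrightarrow> deg_le2 W"
proof -
  have "deg_le2 (shift_set a W)" if "deg_le2 W" for a W
    using that unfolding deg_le2_def shift_set_iff by (metis add_left_cancel)
  moreover have "shift_set (- a) (shift_set a W) = W" by (simp add: shift_set_def image_image)
  ultimately show ?thesis by metis
qed

text \<open>A translation permutes the edges, and the coordinates are i.i.d.\<close>

lemma distr_shift:
  shows "shift a \<in> cdp_space E \<rightarrow>\<^sub>M cdp_space E"
    and "distr (cdp_space E) (cdp_space E) (shift a) = cdp_space E"
proof -
  show "shift a \<in> cdp_space E \<rightarrow>\<^sub>M cdp_space E"
    unfolding cdp_space_def shift_def
    by (intro measurable_restrict measurable_component_singleton) (simp add: translate_edge)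
  have "inj ((`) ((+) a))" by (rule injI) (simp add: inj_image_eq_iff)
  then show "distr (cdp_space E) (cdp_space E) (shift a) = cdp_space E"
    unfolding cdp_space_def shift_def
    using distr_PiM_reindex[of E "\<lambda>_. unit_interval" "(`) ((+) a)" E] prob_unit_interval
    by (simp add: translate_edge inj_on_subset[OF _ subset_UNIV])
qed

text \<open>With \<open>deg_le2\<close> included, the end of a half-line is unique for every
  \<open>U\<close> in the event, so the events \<open>B i\<close> below are truly disjoint.\<close>

definition end_event :: "'v \<Rightarrow> 'v \<Rightarrow> ('v set \<Rightarrow> real) set" where
  "end_event y x = {U \<in> space (cdp_space E).
     deg_le2 (conf U) \<and> half_line (conf U) y \<and> x \<in> cluster (conf U) y}"

lemma end_event_sets [measurable]: "end_event y x \<in> sets (cdp_space E)"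
  unfolding end_event_def by measurable

lemma measure_end_event_shift:
  "measure (cdp_space E) (end_event (a + y) (a + x)) = measure (cdp_space E) (end_event y x)"
proof -
  have "measure (cdp_space E) (end_event y x) =
      measure (distr (cdp_space E) (cdp_space E) (shift a)) (end_event y x)"
    by (simp only: distr_shift(2))
  also have "\<dots> = measure (cdp_space E) (shift a -` end_event y x \<inter> space (cdp_space E))"
    by (rule measure_distr[OF distr_shift(1) end_event_sets])
  also have "shift a -` end_event y x \<inter> space (cdp_space E) = end_event (a + y) (a + x)"
    using measurable_space[OF distr_shift(1)]
    by (auto simp: end_event_def conf_shift half_line_shift deg_le2_shift cluster_shift)
  finally show ?thesis ..
qed

text \<open>
  Mass transport: by translation invariance the expected number of \<open>x\<close> on a half-line ending at \<open>y\<close> equals the expected number of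
  ends of half-lines through \<open>y\<close>, which is at most one. By Borel--Cantelli a half-line ending at \<open>y\<close> would be finite.
\<close>

lemma AE_no_half_line: "AE U in cdp_space E. \<forall>y. \<not> half_line (conf U) y"
proof -
  have "AE U in cdp_space E. \<not> half_line (conf U) y" for y
  proof -
    \<comment> \<open>Indices that code no vertex get the empty event, so no vertex is counted
      twice.\<close>
    define v :: "nat \<Rightarrow> 'v" where "v = from_nat"
    define A where "A i = (if i \<in> range (to_nat :: 'v \<Rightarrow> nat) then end_event y (v i) else {})" for i
    \<comment> \<open>\<open>y - v i + y\<close> is the reflection of \<open>v i\<close> in
      \<open>y\<close>: translation by \<open>y - v i\<close> takes \<open>(y, v i)\<close> to
      \<open>(y - v i + y, y)\<close>.\<close>
    define B where "B i = (if i \<in> range (to_nat :: 'v \<Rightarrow> nat) then end_event (y - v i + y) y else {})" for i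
    have AB: "measure (cdp_space E) (A i) = measure (cdp_space E) (B i)" for i
      using measure_end_event_shift[of "y - v i" y "v i"] by (simp add: A_def B_def)
    \<comment> \<open>Two ends in the cluster of \<open>y\<close> coincide, and the reflection is
      injective.\<close>
    have "disjoint_family B"
      unfolding disjoint_family_on_def
    proof (intro ballI impI)
      fix i j :: nat assume ij: "i \<noteq> j"
      show "B i \<inter> B j = {}"
      proof (rule ccontr)
        assume "B i \<inter> B j \<noteq> {}"
        then obtain U where U: "U \<in> B i" "U \<in> B j" by blast
        then obtain p q :: 'v where pq: "i = to_nat p" "j = to_nat q"
          by (auto simp: B_def split: if_splits)
        let ?W = "conf U" and ?p = "y - p + y" and ?q = "y - q + y"
        have *: "deg_le2 ?W" "half_line ?W ?p" "half_line ?W ?q" "y \<in> cluster ?W ?p" "y \<in> cluster ?W ?q"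
          using U pq by (auto simp: B_def end_event_def v_def)
        have "?q \<in> cluster ?W ?p" using *(4) cluster_sym[OF *(5)] by (rule cluster_trans)
        moreover have "low ?W ?q" using *(3) by (simp add: half_line_def)
        ultimately have "?q = ?p"
          by (rule half_line_end_unique[OF *(1) no_loop_subset[OF conf_subset] *(2)])
        then show False using ij pq by simp
      qed
    qed
    moreover have "range B \<subseteq> sets (cdp_space E)" by (auto simp: B_def)
    ultimately have "(\<lambda>i. measure (cdp_space E) (B i)) sums measure (cdp_space E) (\<Union>i. B i)"
      by (intro cdp.finite_measure_UNION)
    then have "summable (\<lambda>i. measure (cdp_space E) (A i))" unfolding AB by (rule sums_summable)
    moreover have "A i \<in> sets (cdp_space E)" for i by (simp add: A_def)
    ultimately have "AE U in cdp_space E. \<forall>\<^sub>F i in sequentially. U \<in> space (cdp_space E) - A i"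
      by (intro borel_cantelli_AE1) (auto simp: cdp.emeasure_eq_measure)
    then show ?thesis using AE_regular AE_space
    proof eventually_elim
      case (elim U)
      show ?case
      proof
        assume hl: "half_line (conf U) y"
        obtain N where N: "\<And>i. i \<ge> N \<Longrightarrow> U \<notin> A i" using elim(1) by (auto simp: eventually_sequentially)
        have "U \<in> A (to_nat x)" if "x \<in> cluster (conf U) y" for x
          using that hl elim deg_le2_conf by (simp add: A_def v_def end_event_def)
        then have "to_nat ` cluster (conf U) y \<subseteq> {..<N}" using N by (meson image_subsetI lessThan_iff not_le)
        then have "finite (to_nat ` cluster (conf U) y)" by (rule finite_subset) simp
        then show False using hl by (simp add: half_line_def finite_image_iff)
      qed
    qed
  qed
  then show ?thesis by (simp add: AE_all_countable)
qed

text \<open>Surgery turns an infinite cluster into a half-line of some \<open>W\<close>, while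
  resampling realises \<open>W\<close> by times without half-lines.\<close>

lemma AE_finite_clusters: "AE U in cdp_space E. \<forall>v. finite (cluster (conf U) v)"
proof -
  define \<F> where "\<F> = {F. finite F \<and> F \<subseteq> E}"
  have "countable \<F>" unfolding \<F>_def by (rule countable_Collect_finite_subset[OF countable_E])
  let ?\<phi> = "\<lambda>V. regular V \<and> (\<forall>y. \<not> half_line (conf V) y)"
  have \<phi>: "AE U in cdp_space E. ?\<phi> U" using AE_regular AE_no_half_line by eventually_elim blast
  have "AE U in cdp_space E. \<exists>V. (\<forall>e. e \<notin> F \<longrightarrow> V e = U e) \<and> (\<forall>e\<in>F. 1 - 1 / real (Suc n) < V e) \<and> ?\<phi> V"
    if "F \<in> \<F>" for F n
    using that \<phi> by (intro AE_make_late) (auto simp: \<F>_def field_simps)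
  \<comment> \<open>\<open>F\<close> and \<open>n\<close> will depend on \<open>U\<close>; there are
    countably many pairs, so the null set can be chosen first.\<close>
  then have "AE U in cdp_space E. \<forall>F\<in>\<F>. \<forall>n. \<exists>V. (\<forall>e. e \<notin> F \<longrightarrow> V e = U e) \<and>
      (\<forall>e\<in>F. 1 - 1 / real (Suc n) < V e) \<and> ?\<phi> V"
    by (simp add: AE_ball_countable[OF \<open>countable \<F>\<close>] AE_all_countable)
  then show ?thesis using AE_regular
  proof eventually_elim
    case (elim U)
    show ?case
    proof (intro allI, rule ccontr)
      fix v assume inf: "infinite (cluster (conf U) v)"
      obtain W y where W: "near (conf U) W" "addable W = {}" "half_line W y"
        using exists_near_half_line[OF conf_subset deg_le2_conf[OF elim(2)] addable_conf[OF elim(2)] inf] .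
      obtain F and n :: nat where F: "finite F" "F \<subseteq> E"
        and mod: "\<forall>V. regular V \<and> (\<forall>e. e \<notin> F \<longrightarrow> V e = U e) \<and>
          (\<forall>e\<in>F. 1 - 1 / real (Suc n) < V e) \<longrightarrow> conf V = W"
        using conf_modification[OF elim(2) W(1,2)] .
      have "F \<in> \<F>" using F by (simp add: \<F>_def)
      then obtain V where V: "\<forall>e. e \<notin> F \<longrightarrow> V e = U e" "\<forall>e\<in>F. 1 - 1 / real (Suc n) < V e" "?\<phi> V"
        using elim(1) by blast
      then have "conf V = W" using mod by blast
      then show False using V(3) W(3) by blast
    qed
  qed
qed

lemma cdp_theta_2: "cdp_theta E (\<lambda>_. 2) v t = 0"
proof -
  have "AE U in cdp_space E. U \<notin> percolation_event E (\<lambda>_. 2) v t"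
    using AE_regular AE_finite_clusters
  proof eventually_elim
    case (elim U)
    \<comment> \<open>An edge open at \<open>t\<close> has a time below \<open>t \<le> 1\<close>, so
      it is open at time 1.\<close>
    have "{u, w} \<in> conf U" if "{u, w} \<in> E" "cdp_config E (\<lambda>_. 2) U t {u, w}" for u w
    proof -
      have "cdp_config E (\<lambda>_. 2) U t {u, w} \<longleftrightarrow>
          t \<in> {0..1} \<and> {u, w} \<in> E \<and> U {u, w} < t \<and> (\<exists>n. \<forall>m\<ge>n. approx (\<lambda>_. 2) m U {u, w})"
        using elim(1) by (intro config_if_wf(2)) (simp_all add: regular_def)
      then show ?thesis using that by (auto simp: conf_def)
    qed
    then have "{x. open_connected E (cdp_config E (\<lambda>_. 2) U t) v x} \<subseteq> cluster (conf U) v"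
      unfolding open_connected_def cluster_def by (auto elim!: rtranclp_mono[THEN predicate2D, rotated])
    then show ?case using elim(2) finite_subset by (auto simp: percolation_event_def)
  qed
  then have "percolation_event E (\<lambda>_. 2) v t \<in> null_sets (completion (cdp_space E))"
    using AE_iff_null_sets[OF percolation_event_measurable] AE_completion by blast
  then show ?thesis unfolding cdp_theta_def by (rule measure_eq_0_null_sets)
qed

end

subsection \<open>The hypercubic lattice\<close>

lemma sum_abs_eq_1_axis:
  fixes z :: "int ^ 'd::finite"
  assumes "(\<Sum>i\<in>UNIV. \<bar>z $ i\<bar>) = 1"
  obtains i s where "\<bar>s\<bar> = 1" "z = axis i s"
proof -
  have "z \<noteq> 0" using assms by auto
  then obtain i where i: "z $ i \<noteq> 0" by (auto simp: vec_eq_iff)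
  have sum: "\<bar>z $ i\<bar> + (\<Sum>j\<in>UNIV - {i}. \<bar>z $ j\<bar>) = 1"
    using assms by (subst (asm) sum.remove[of _ i]) auto
  moreover have "0 \<le> (\<Sum>j\<in>UNIV - {i}. \<bar>z $ j\<bar>)" by (rule sum_nonneg) simp
  ultimately have "\<bar>z $ i\<bar> = 1" "(\<Sum>j\<in>UNIV - {i}. \<bar>z $ j\<bar>) = 0" using i by linarith+
  then have "z $ j = 0" if "j \<noteq> i" for j
    using that sum_nonneg_eq_0_iff[of "UNIV - {i}" "\<lambda>j. \<bar>z $ j\<bar>"] by auto
  then have "z = axis i (z $ i)" by (auto simp: vec_eq_iff axis_def)
  then show thesis using that \<open>\<bar>z $ i\<bar> = 1\<close> by blast
qed

text \<open>As the sum is nonzero, nothing cancels on the right at coordinate \<open>k\<close>; the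
  entry there has the sign of \<open>r\<close>, and a summand on the left has to supply it.\<close>

lemma axis_sum_representation:
  fixes s s' r r' :: int
  assumes eq: "axis i s + axis j s' = axis k r + (axis l r' :: int ^ 'd::finite)"
    and ne: "axis i s + axis j s' \<noteq> (0 :: int ^ 'd)"
    and abs: "\<bar>s\<bar> = 1" "\<bar>s'\<bar> = 1" "\<bar>r\<bar> = 1" "\<bar>r'\<bar> = 1"
  shows "axis k r = (axis i s :: int ^ 'd) \<or> axis k r = (axis j s' :: int ^ 'd)"
proof -
  have k: "(if i = k then s else 0) + (if j = k then s' else 0) = r + (if l = k then r' else 0)"
    using arg_cong[OF eq, of "\<lambda>z. z $ k"] by (simp add: axis_def eq_commute)
  have "r + r' \<noteq> 0" if "l = k"
  proof
    assume "r + r' = 0"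
    then have "axis k r + (axis l r' :: int ^ 'd) = 0" using that by (auto simp: vec_eq_iff axis_def)
    then show False using eq ne by simp
  qed
  then have "i = k \<and> s = r \<or> j = k \<and> s' = r"
    using k abs by (auto split: if_splits)
  then show ?thesis by auto
qed

lemma translation_invariant_hypercubic:
  assumes d: "CARD('d::finite) \<ge> 2"
  shows "translation_invariant_graph (hypercubic_edges :: (int ^ 'd) set set)
    (card {z :: int ^ 'd. (\<Sum>i\<in>UNIV. \<bar>z $ i\<bar>) = 1})"
proof -
  interpret bounded_degree_graph "hypercubic_edges :: (int ^ 'd) set set"
    "card {z :: int ^ 'd. (\<Sum>i\<in>UNIV. \<bar>z $ i\<bar>) = 1}"
    by (rule bounded_degree_hypercubic)
  show ?thesis
  proof
    fix v a b :: "int ^ 'd"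
    \<comment> \<open>Two directions yield three neighbours of \<open>v\<close>, one of which
      differs from \<open>a\<close> and \<open>b\<close>.\<close>
    obtain i j :: 'd where ij: "i \<noteq> j" by (metis (full_types) UNIV_I card_2_iff' d ex_card)
    have nb: "{v, v + axis k s} \<in> hypercubic_edges" if "\<bar>s\<bar> = 1" for k s
    proof -
      have "\<bar>v $ l - (v + axis k s) $ l\<bar> = (if l = k then 1 else 0)" for l
        using that by (simp add: axis_def)
      then show ?thesis unfolding hypercubic_adj by simp
    qed
    have "axis i 1 \<noteq> (axis i (-1) :: int ^ 'd)" "axis i 1 \<noteq> (axis j 1 :: int ^ 'd)"
      "axis i (-1) \<noteq> (axis j 1 :: int ^ 'd)"
      using ij by (auto simp: axis_eq_axis)
    then have "\<exists>c\<in>{v + axis i 1, v + axis i (-1), v + axis j 1}. c \<noteq> a \<and> c \<noteq> b"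
      by (metis add_left_cancel insertI1 insertI2)
    then show "\<exists>c. {v, c} \<in> hypercubic_edges \<and> c \<noteq> a \<and> c \<noteq> b" using nb[of 1 i] nb[of "-1" i] nb[of 1 j] by auto
  next
    fix u v w :: "int ^ 'd"
    assume uv: "{u, v} \<in> hypercubic_edges" and vw: "{v, w} \<in> hypercubic_edges"
    \<comment> \<open>Parity of the coordinate sum: the three differences around a triangle cannot
      all be odd.\<close>
    have odd: "odd ((\<Sum>i\<in>UNIV. x $ i) - (\<Sum>i\<in>UNIV. y $ i))" if "{x, y} \<in> hypercubic_edges" for x y :: "int ^ 'd"
    proof -
      have "even (\<bar>k\<bar> - k)" for k :: int by (cases "k \<ge> 0") auto
      then have "even (\<Sum>i\<in>UNIV. \<bar>x $ i - y $ i\<bar> - (x $ i - y $ i))" by (intro dvd_sum)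
      then show ?thesis using that unfolding hypercubic_adj by (simp add: sum_subtractf)
    qed
    show "{u, w} \<notin> hypercubic_edges"
      using odd[OF uv] odd[OF vw] odd[of u w] by auto
  next
    fix u v p q r :: "int ^ 'd"
    assume uv: "u \<noteq> v"
    \<comment> \<open>A common neighbour splits \<open>v - u\<close> into two signed unit vectors,
      and by \<open>axis_sum_representation\<close> only two first summands are possible.\<close>
    have rep: "\<exists>i s j s'. \<bar>s\<bar> = 1 \<and> \<bar>s'\<bar> = 1 \<and> x - u = axis i s \<and> v - u = axis i s + axis j s'"
      if "{u, x} \<in> hypercubic_edges" "{v, x} \<in> hypercubic_edges" for x
    proof -
      have "(\<Sum>i\<in>UNIV. \<bar>(x - u) $ i\<bar>) = 1" "(\<Sum>i\<in>UNIV. \<bar>(v - x) $ i\<bar>) = 1"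
        using that unfolding hypercubic_adj by (simp_all add: abs_minus_commute)
      then obtain i s j s' where "\<bar>s\<bar> = 1" "x - u = axis i s" "\<bar>s'\<bar> = 1" "v - x = axis j s'"
        by (metis sum_abs_eq_1_axis)
      moreover have "v - u = (x - u) + (v - x)" by simp
      ultimately show ?thesis by metis
    qed
    assume p: "{u, p} \<in> hypercubic_edges" "{v, p} \<in> hypercubic_edges"
      and q: "{u, q} \<in> hypercubic_edges" "{v, q} \<in> hypercubic_edges"
      and r: "{u, r} \<in> hypercubic_edges" "{v, r} \<in> hypercubic_edges"
    obtain i s j s' where ps: "\<bar>s\<bar> = 1" "\<bar>s'\<bar> = 1" "p - u = axis i s" "v - u = axis i s + axis j s'"
      using rep[OF p] by blast
    have two: "x - u = axis i s \<or> x - u = axis j s'"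
      if ux: "{u, x} \<in> hypercubic_edges" and vx: "{v, x} \<in> hypercubic_edges" for x
    proof -
      obtain k t l t' where x: "\<bar>t\<bar> = 1" "\<bar>t'\<bar> = 1" "x - u = axis k t" "v - u = axis k t + axis l t'"
        using rep[OF ux vx] by blast
      have "v - u \<noteq> 0" using uv by simp
      then show ?thesis unfolding x(3)
        by (intro axis_sum_representation[of i s j s' k t l t']) (use ps x in auto)
    qed
    show "p = q \<or> p = r \<or> q = r"
      using two[OF q] two[OF r] ps(3) by (metis diff_add_cancel)
  next
    show "{a + u, a + w} \<in> hypercubic_edges \<longleftrightarrow> {u, w} \<in> hypercubic_edges" for a u w :: "int ^ 'd"
      by (simp add: hypercubic_adj)
  qed
qed

theorem proposition1:
  fixes t :: real
  assumes "CARD('d::finite) \<ge> 2" and "t \<in> {0..1}"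
  shows "cdp_theta (hypercubic_edges :: (int ^ 'd) set set) (\<lambda>_. 2) 0 t = 0"
  by (rule translation_invariant_graph.cdp_theta_2[OF translation_invariant_hypercubic[OF assms(1)]])

end
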